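(* Let $K\hookrightarrow L$ be a finite separable field extension, $x$ a generator of $L$ over $K$ (so $L=K[x]$), $n$ the degree of $x$ over $K$, $\nu$ a valuation of $K$ (of arbitrary rank), and $\nu'$ an extension of $\nu$ to $L$. Assume that $\mathrm{in}_{\nu'}x$ has degree $n$ over $G_\nu$. Then $\nu$ admits a unique extension $\nu'$ to $L$.
   Context: For a valuation $\nu:K^*\to\Gamma$ put $\mathbf P_\beta=\{y\in K^*:\nu(y)\ge\beta\}\cup\{0\}$, $\mathbf P_{\beta+}=\{y\in K^*:\nu(y)>\beta\}\cup\{0\}$ and $G_\nu=\bigoplus_{\beta\in\Gamma}\mathbf P_\beta/\mathbf P_{\beta+}$, a graded integral domain in which every non-zero homogeneous element is invertible. $G_{\nu'}$ is defined in the same way from $L$ and $\nu'$ (values in a group containing $\Gamma$), and $G_\nu\subset G_{\nu'}$. For $y\in L^*$, $\mathrm{in}_{\nu'}y$ denotes the natural image of $y$ in $\mathbf P'_{\nu'(y)}/\mathbf P'_{\nu'(y)+}\subset G_{\nu'}$. The degree of the homogeneous element $\mathrm{in}_{\nu'}x$ over $G_\nu$ is the degree of its minimal polynomial over $G_\nu$, i.e. the smallest degree $\alpha$ of a relation $a_0(\mathrm{in}_{\nu'}x)^\alpha+\dots+a_\alpha=0$ with $a_j\in G_\nu$, $a_0\ne0$. *)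

theory Defs
  imports "HOL-Algebra.Algebra"
begin

section \<open>Separable extensions\<close>

text \<open>
  Polynomials are coefficient lists with the leading coefficient first, as in
  \<^theory>\<open>HOL-Algebra.Polynomials\<close>.
\<close>

definition (in ring) formal_deriv :: "'a list \<Rightarrow> 'a list"
  where "formal_deriv p =
    normalize (map (\<lambda>i. [Suc i] \<cdot> coeff p (Suc i)) (rev [0..<degree p]))"

definition (in ring) separable_poly :: "'a set \<Rightarrow> 'a list \<Rightarrow> bool"
  where "separable_poly K p \<longleftrightarrow>
    (\<forall>d \<in> carrier (K[X]).
       d divides\<^bsub>K[X]\<^esub> p \<longrightarrow> d divides\<^bsub>K[X]\<^esub> formal_deriv p \<longrightarrow> d \<in> Units (K[X]))"

definition (in ring) separable_extension :: "'a set \<Rightarrow> bool"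
  where "separable_extension K \<longleftrightarrow>
    (\<forall>y \<in> carrier R. algebraic K y \<and> separable_poly K (Irr K y))"


section \<open>Valuations\<close>

text \<open>
  Valuations are written additively.  Only the values at non-zero elements matter; the
  value of the function at zero is arbitrary.
\<close>

definition valuation :: "('a, 'b) ring_scheme \<Rightarrow> ('a \<Rightarrow> 'g::linordered_ab_group_add) \<Rightarrow> bool"
  where "valuation F v \<longleftrightarrow>
    (\<forall>y \<in> carrier F - {\<zero>\<^bsub>F\<^esub>}. \<forall>z \<in> carrier F - {\<zero>\<^bsub>F\<^esub>}.
       v (y \<otimes>\<^bsub>F\<^esub> z) = v y + v z \<and>
       (y \<oplus>\<^bsub>F\<^esub> z \<noteq> \<zero>\<^bsub>F\<^esub> \<longrightarrow> min (v y) (v z) \<le> v (y \<oplus>\<^bsub>F\<^esub> z)))"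

definition ordered_group_embedding ::
    "('g::linordered_ab_group_add \<Rightarrow> 'h::linordered_ab_group_add) \<Rightarrow> bool"
  where "ordered_group_embedding \<iota> \<longleftrightarrow>
    (\<forall>\<alpha> \<beta>. \<iota> (\<alpha> + \<beta>) = \<iota> \<alpha> + \<iota> \<beta>) \<and> strict_mono \<iota>"

text \<open>
  The inclusion of the group of values of \<open>v\<close> into that of the extension \<open>w\<close> is the
  embedding \<open>\<iota>\<close>.
\<close>

definition extends_valuation ::
    "('a, 'b) ring_scheme \<Rightarrow> 'a set \<Rightarrow> ('a \<Rightarrow> 'g::linordered_ab_group_add) \<Rightarrow>
     ('g \<Rightarrow> 'h::linordered_ab_group_add) \<Rightarrow> ('a \<Rightarrow> 'h) \<Rightarrow> bool"
  where "extends_valuation L K v \<iota> w \<longleftrightarrow>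
    valuation L w \<and> (\<forall>y \<in> K - {\<zero>\<^bsub>L\<^esub>}. w y = \<iota> (v y))"

text \<open>
  Valuations of the same field with values in different groups are compared in the usual way,
  through an order isomorphism between their value groups.
\<close>

definition equivalent_valuations ::
    "('a, 'b) ring_scheme \<Rightarrow> ('a \<Rightarrow> 'g::linordered_ab_group_add) \<Rightarrow>
     ('a \<Rightarrow> 'h::linordered_ab_group_add) \<Rightarrow> bool"
  where "equivalent_valuations F v w \<longleftrightarrow>
    (\<exists>\<phi>. bij_betw \<phi> (v ` (carrier F - {\<zero>\<^bsub>F\<^esub>})) (w ` (carrier F - {\<zero>\<^bsub>F\<^esub>})) \<and>
         strict_mono_on (v ` (carrier F - {\<zero>\<^bsub>F\<^esub>})) \<phi> \<and>
         (\<forall>\<alpha> \<in> v ` (carrier F - {\<zero>\<^bsub>F\<^esub>}). \<forall>\<beta> \<in> v ` (carrier F - {\<zero>\<^bsub>F\<^esub>}).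
            \<phi> (\<alpha> + \<beta>) = \<phi> \<alpha> + \<phi> \<beta>) \<and>
         (\<forall>y \<in> carrier F - {\<zero>\<^bsub>F\<^esub>}. w y = \<phi> (v y)))"


section \<open>The graded ring of a valuation\<close>

definition val_ge :: "('a, 'b) ring_scheme \<Rightarrow> ('a \<Rightarrow> 'g::linordered_ab_group_add) \<Rightarrow> 'g \<Rightarrow> 'a set"
  where "val_ge F v \<beta> = {y \<in> carrier F - {\<zero>\<^bsub>F\<^esub>}. v y \<ge> \<beta>} \<union> {\<zero>\<^bsub>F\<^esub>}"

definition val_gt :: "('a, 'b) ring_scheme \<Rightarrow> ('a \<Rightarrow> 'g::linordered_ab_group_add) \<Rightarrow> 'g \<Rightarrow> 'a set"
  where "val_gt F v \<beta> = {y \<in> carrier F - {\<zero>\<^bsub>F\<^esub>}. v y > \<beta>} \<union> {\<zero>\<^bsub>F\<^esub>}"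

text \<open>
  The homogeneous component of degree \<open>\<beta>\<close>.  The quotient is the library's (multiplicatively
  written) factor group; its neutral element is the coset \<^term>\<open>val_gt F v \<beta>\<close>.
\<close>

definition gr_comp ::
    "('a, 'b) ring_scheme \<Rightarrow> ('a \<Rightarrow> 'g::linordered_ab_group_add) \<Rightarrow> 'g \<Rightarrow> 'a set monoid"
  where "gr_comp F v \<beta> =
    \<lparr>carrier = val_ge F v \<beta>, monoid.mult = add F, one = \<zero>\<^bsub>F\<^esub>\<rparr> Mod val_gt F v \<beta>"

text \<open>
  The product of a class of degree \<open>\<alpha>\<close> and a class of degree \<open>\<gamma> - \<alpha>\<close>, which is a class
  of degree \<open>\<gamma>\<close>.
\<close>

definition gr_comp_mult ::
    "('a, 'b) ring_scheme \<Rightarrow> ('a \<Rightarrow> 'g::linordered_ab_group_add) \<Rightarrow> 'g \<Rightarrow>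
     'a set \<Rightarrow> 'a set \<Rightarrow> 'a set"
  where "gr_comp_mult F v \<gamma> U V =
    (\<Union>y \<in> U. \<Union>z \<in> V. val_gt F v \<gamma> +>\<^bsub>F\<^esub> (y \<otimes>\<^bsub>F\<^esub> z))"

definition gr_ring ::
    "('a, 'b) ring_scheme \<Rightarrow> ('a \<Rightarrow> 'g::linordered_ab_group_add) \<Rightarrow> ('g \<Rightarrow> 'a set) ring"
  where "gr_ring F v =
    \<lparr>carrier = carrier (sum_group UNIV (gr_comp F v)),
     monoid.mult = (\<lambda>f g \<gamma>. finprod (gr_comp F v \<gamma>)
        (\<lambda>\<alpha>. gr_comp_mult F v \<gamma> (f \<alpha>) (g (\<gamma> - \<alpha>))) {\<alpha>. f \<alpha> \<noteq> val_gt F v \<alpha>}),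
     one = (\<lambda>\<beta>. if \<beta> = 0 then val_gt F v 0 +>\<^bsub>F\<^esub> \<one>\<^bsub>F\<^esub> else val_gt F v \<beta>),
     ring.zero = \<one>\<^bsub>sum_group UNIV (gr_comp F v)\<^esub>,
     ring.add = (\<otimes>\<^bsub>sum_group UNIV (gr_comp F v)\<^esub>)\<rparr>"

text \<open>At \<open>y = 0\<close> this is the zero element, whatever \<^term>\<open>v y\<close> is.\<close>

definition initial_form ::
    "('a, 'b) ring_scheme \<Rightarrow> ('a \<Rightarrow> 'g::linordered_ab_group_add) \<Rightarrow> 'a \<Rightarrow> ('g \<Rightarrow> 'a set)"
  where "initial_form F v y =
    (\<lambda>\<beta>. if \<beta> = v y then val_gt F v \<beta> +>\<^bsub>F\<^esub> y else val_gt F v \<beta>)"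

text \<open>
  The natural map from the graded ring of a subfield, with values in \<^typ>\<open>'g\<close>, to the graded
  ring of \<open>L\<close>: in degree \<open>\<iota> \<beta>\<close> it sends the class of \<open>y\<close> to the class of \<open>y\<close>; the components
  in degrees outside the range of \<open>\<iota>\<close> are zero.
\<close>

definition gr_map ::
    "('a, 'b) ring_scheme \<Rightarrow> ('g::linordered_ab_group_add \<Rightarrow> 'h::linordered_ab_group_add) \<Rightarrow>
     ('a \<Rightarrow> 'h) \<Rightarrow> ('g \<Rightarrow> 'a set) \<Rightarrow> ('h \<Rightarrow> 'a set)"
  where "gr_map L \<iota> w f =
    (\<lambda>\<beta>. if \<beta> \<in> range \<iota> then val_gt L w \<beta> <+>\<^bsub>L\<^esub> f (inv_into UNIV \<iota> \<beta>) else val_gt L w \<beta>)"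

definition gr_subring ::
    "('a, 'b) ring_scheme \<Rightarrow> 'a set \<Rightarrow> ('a \<Rightarrow> 'g::linordered_ab_group_add) \<Rightarrow>
     ('g \<Rightarrow> 'h::linordered_ab_group_add) \<Rightarrow> ('a \<Rightarrow> 'h) \<Rightarrow> ('h \<Rightarrow> 'a set) set"
  where "gr_subring L K v \<iota> w = gr_map L \<iota> w ` carrier (gr_ring (L\<lparr>carrier := K\<rparr>) v)"

text \<open>
  The element \<open>z\<close> is algebraic over \<open>S\<close>, and \<open>d\<close> is the smallest degree of a non-zero polynomial
  over \<open>S\<close> vanishing at \<open>z\<close>; the leading coefficient need not be invertible.
\<close>

definition (in ring) has_degree_over :: "'a set \<Rightarrow> 'a \<Rightarrow> nat \<Rightarrow> bool"
  where "has_degree_over S z d \<longleftrightarrow>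
    (\<exists>p \<in> carrier (S[X]). p \<noteq> [] \<and> eval p z = \<zero> \<and> degree p = d) \<and>
    (\<forall>p \<in> carrier (S[X]). p \<noteq> [] \<and> eval p z = \<zero> \<longrightarrow> d \<le> degree p)"


section \<open>The graded ring is a commutative ring\<close>

text \<open>
  Polynomial evaluation in \<^const>\<open>gr_ring\<close>, hence \<^const>\<open>ring.has_degree_over\<close>, has its
  intended meaning because of \<open>G_cring\<close> below; \<open>gr_map_initial_form\<close> says that
  \<^const>\<open>gr_map\<close> is the natural map.
\<close>

locale valued_field = field F for F (structure) +
  fixes v :: "'a \<Rightarrow> 'g::linordered_ab_group_add"
  assumes val: "valuation F v"
begin

abbreviation "GE \<equiv> val_ge F v"
abbreviation "GT \<equiv> val_gt F v"
abbreviation "H \<equiv> \<lambda>\<beta> y. GT \<beta> +>\<^bsub>F\<^esub> y"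
abbreviation "C \<equiv> gr_comp F v"

lemma v_mult: "\<lbrakk>y \<in> carrier F; z \<in> carrier F; y \<noteq> \<zero>; z \<noteq> \<zero>\<rbrakk> \<Longrightarrow> v (y \<otimes> z) = v y + v z"
  and v_add: "\<lbrakk>y \<in> carrier F; z \<in> carrier F; y \<noteq> \<zero>; z \<noteq> \<zero>; y \<oplus> z \<noteq> \<zero>\<rbrakk> \<Longrightarrow> min (v y) (v z) \<le> v (y \<oplus> z)"
  using val unfolding valuation_def by auto

lemma v_one: "v \<one> = 0"
  using v_mult[of \<one> \<one>] by simp

lemma v_neg_one: "v (\<ominus> \<one>) = 0"
proof -
  have "\<ominus> \<one> \<otimes> \<ominus> \<one> = \<one>" by (simp add: l_minus r_minus)
  moreover have "\<ominus> \<one> \<noteq> \<zero>" by (metis local.minus_equality local.minus_zero one_closed one_not_zero minus_minus)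
  ultimately have "v (\<ominus> \<one>) + v (\<ominus> \<one>) = 0" using v_mult[of "\<ominus> \<one>" "\<ominus> \<one>"] v_one by simp
  thus ?thesis by (metis add_neg_neg add_pos_pos less_irrefl linorder_cases)
qed

lemma v_neg: "\<lbrakk>y \<in> carrier F; y \<noteq> \<zero>\<rbrakk> \<Longrightarrow> v (\<ominus> y) = v y"
  using v_mult[of "\<ominus> \<one>" y] v_neg_one by (metis add_0 a_inv_closed l_minus l_one minus_minus minus_zero one_closed one_not_zero)

lemma GE_iff: "y \<in> GE \<beta> \<longleftrightarrow> y \<in> carrier F \<and> (y = \<zero> \<or> \<beta> \<le> v y)"
  and GT_iff: "y \<in> GT \<beta> \<longleftrightarrow> y \<in> carrier F \<and> (y = \<zero> \<or> \<beta> < v y)"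
  unfolding val_ge_def val_gt_def by auto

lemma GE_carr: "y \<in> GE \<beta> \<Longrightarrow> y \<in> carrier F" by (simp add: GE_iff)
lemma GT_carr: "y \<in> GT \<beta> \<Longrightarrow> y \<in> carrier F" by (simp add: GT_iff)
lemma GT_GE: "y \<in> GT \<beta> \<Longrightarrow> y \<in> GE \<beta>" by (auto simp: GE_iff GT_iff)

lemma GE_add: "\<lbrakk>y \<in> GE \<beta>; z \<in> GE \<beta>\<rbrakk> \<Longrightarrow> y \<oplus> z \<in> GE \<beta>"
  using v_add[of y z] unfolding GE_iff by (cases "y = \<zero>"; cases "z = \<zero>"; cases "y \<oplus> z = \<zero>") (auto simp: min_le_iff_disj)
lemma GT_add: "\<lbrakk>y \<in> GT \<beta>; z \<in> GT \<beta>\<rbrakk> \<Longrightarrow> y \<oplus> z \<in> GT \<beta>"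
  using v_add[of y z] unfolding GT_iff by (cases "y = \<zero>"; cases "z = \<zero>"; cases "y \<oplus> z = \<zero>") (auto simp: min_le_iff_disj)
lemma GE_neg: "y \<in> GE \<beta> \<Longrightarrow> \<ominus> y \<in> GE \<beta>" by (cases "y = \<zero>") (auto simp: GE_iff v_neg)
lemma GT_neg: "y \<in> GT \<beta> \<Longrightarrow> \<ominus> y \<in> GT \<beta>" by (cases "y = \<zero>") (auto simp: GT_iff v_neg)
lemma GE_zero: "\<zero> \<in> GE \<beta>" and GT_zero: "\<zero> \<in> GT \<beta>" by (auto simp: GE_iff GT_iff)

lemma GE_GE_mult: "\<lbrakk>y \<in> GE \<alpha>; z \<in> GE \<beta>\<rbrakk> \<Longrightarrow> y \<otimes> z \<in> GE (\<alpha> + \<beta>)"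
  using v_mult[of y z] unfolding GE_iff by (cases "y = \<zero>"; cases "z = \<zero>") (auto intro: add_mono)
lemma GT_GE_mult: "\<lbrakk>y \<in> GT \<alpha>; z \<in> GE \<beta>\<rbrakk> \<Longrightarrow> y \<otimes> z \<in> GT (\<alpha> + \<beta>)"
  using v_mult[of y z] unfolding GE_iff GT_iff by (cases "y = \<zero>"; cases "z = \<zero>") (auto intro: add_less_le_mono)
lemma GE_GT_mult: "\<lbrakk>y \<in> GE \<alpha>; z \<in> GT \<beta>\<rbrakk> \<Longrightarrow> y \<otimes> z \<in> GT (\<alpha> + \<beta>)"
  using v_mult[of y z] unfolding GE_iff GT_iff by (cases "y = \<zero>"; cases "z = \<zero>") (auto intro: add_le_less_mono)

abbreviation "PA \<beta> \<equiv> \<lparr>carrier = GE \<beta>, monoid.mult = add F, one = \<zero>\<rparr>"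

lemma PA: "comm_group (PA \<beta>)"
proof (rule comm_groupI)
  fix y assume "y \<in> carrier (PA \<beta>)"
  thus "\<exists>z\<in>carrier (PA \<beta>). z \<otimes>\<^bsub>PA \<beta>\<^esub> y = \<one>\<^bsub>PA \<beta>\<^esub>"
    using GE_neg[of y \<beta>] GE_carr[of y \<beta>] by (auto intro!: bexI[of _ "\<ominus> y"] simp: l_neg)
qed (auto simp: GE_add GE_zero GE_carr a_ac)

lemma GT_sub: "subgroup (GT \<beta>) (PA \<beta>)"
proof (rule group.subgroupI)
  show "Group.group (PA \<beta>)" using PA comm_group.axioms(2) by blast
  fix y assume y: "y \<in> GT \<beta>"
  have "inv\<^bsub>PA \<beta>\<^esub> y = \<ominus> y"
    by (rule group.inv_equality) (use PA comm_group.axioms(2) y in \<open>auto simp: GT_GE GT_carr l_neg GE_neg\<close>)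
  thus "inv\<^bsub>PA \<beta>\<^esub> y \<in> GT \<beta>" using GT_neg[OF y] by simp
qed (auto simp: GT_add GT_GE intro: GT_zero)

lemma GT_normal: "GT \<beta> \<lhd> PA \<beta>"
  using PA GT_sub by (simp add: comm_group.normal_iff_subgroup)

lemma C_comm_group: "comm_group (C \<beta>)"
  unfolding gr_comp_def by (rule comm_group.abelian_FactGroup[OF PA GT_sub])
lemma C_group: "Group.group (C \<beta>)" using C_comm_group comm_group.axioms(2) by blast

lemma rc: "r_coset (PA \<beta>) = a_r_coset F"
  unfolding a_r_coset_def r_coset_def by simp

lemma C_carrier: "carrier (C \<beta>) = H \<beta> ` GE \<beta>"
  unfolding gr_comp_def carrier_FactGroup by (simp add: rc)

lemma C_one: "\<one>\<^bsub>C \<beta>\<^esub> = GT \<beta>" unfolding gr_comp_def by simp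

lemma C_mult: "\<lbrakk>y \<in> GE \<beta>; z \<in> GE \<beta>\<rbrakk> \<Longrightarrow> H \<beta> y \<otimes>\<^bsub>C \<beta>\<^esub> H \<beta> z = H \<beta> (y \<oplus> z)"
  using normal.rcos_sum[OF GT_normal[of \<beta>], of y z] unfolding gr_comp_def by (simp add: rc)

lemma mem_H: "u \<in> H \<beta> y \<longleftrightarrow> (\<exists>h\<in>GT \<beta>. u = h \<oplus> y)"
  unfolding a_r_coset_def r_coset_def by auto

lemma self_H: "y \<in> carrier F \<Longrightarrow> y \<in> H \<beta> y"
  unfolding mem_H using GT_zero by force

lemma H_eqI: assumes "u \<in> H \<beta> y" "y \<in> GE \<beta>" shows "H \<beta> u = H \<beta> y"
  using normal.axioms(1)[OF GT_normal[of \<beta>]] assms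
    subgroup.subset[OF GT_sub[of \<beta>]] group.repr_independence[of "PA \<beta>" u "GT \<beta>" y] PA[of \<beta>] GT_sub[of \<beta>]
  by (simp add: rc comm_group.axioms(2))

lemma H_zero: "H \<beta> \<zero> = GT \<beta>"
  using GT_carr by (auto simp: set_eq_iff mem_H) 

lemma GT_in_C: "GT \<beta> \<in> carrier (C \<beta>)" using H_zero[of \<beta>] GE_zero[of \<beta>] unfolding C_carrier by blast

lemma cm: assumes y: "y \<in> GE \<alpha>" and z: "z \<in> GE (\<gamma> - \<alpha>)"
  shows "gr_comp_mult F v \<gamma> (H \<alpha> y) (H (\<gamma> - \<alpha>) z) = H \<gamma> (y \<otimes> z)"
proof -
  have yz: "y \<otimes> z \<in> GE \<gamma>" using GE_GE_mult[OF y z] by simp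
  have "H \<gamma> (y' \<otimes> z') = H \<gamma> (y \<otimes> z)" if yy: "y' \<in> H \<alpha> y" and zz: "z' \<in> H (\<gamma> - \<alpha>) z" for y' z'
  proof -
    obtain g h where g: "g \<in> GT \<alpha>" "y' = g \<oplus> y" and h: "h \<in> GT (\<gamma> - \<alpha>)" "z' = h \<oplus> z"
      using yy zz mem_H[of y' \<alpha> y] mem_H[of z' "\<gamma> - \<alpha>" z] by blast
    have c: "g \<in> carrier F" "h \<in> carrier F" "y \<in> carrier F" "z \<in> carrier F"
      using g h y z GT_carr GE_carr by auto
    have "y' \<otimes> z' = (g \<otimes> (h \<oplus> z) \<oplus> y \<otimes> h) \<oplus> y \<otimes> z"
      using c g h by (simp add: l_distr r_distr a_ac)
    moreover have "g \<otimes> (h \<oplus> z) \<oplus> y \<otimes> h \<in> GT \<gamma>"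
      using GT_add[OF GT_GE_mult[OF g(1) GE_add[OF GT_GE[OF h(1)] z]] GE_GT_mult[OF y h(1)]] by simp
    ultimately show ?thesis by (intro H_eqI[OF _ yz]) (auto simp: mem_H)
  qed
  moreover have "y \<in> H \<alpha> y" "z \<in> H (\<gamma> - \<alpha>) z" using self_H y z GE_carr by auto
  ultimately show ?thesis unfolding gr_comp_mult_def by blast
qed

abbreviation "cmul \<equiv> gr_comp_mult F v"

lemma CE: "U \<in> carrier (C \<beta>) \<Longrightarrow> (\<And>y. \<lbrakk>y \<in> GE \<beta>; U = H \<beta> y\<rbrakk> \<Longrightarrow> P) \<Longrightarrow> P"
  unfolding C_carrier by blast

lemma H_C: "y \<in> GE \<beta> \<Longrightarrow> H \<beta> y \<in> carrier (C \<beta>)" unfolding C_carrier by blast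

lemma cmul_closed: "\<lbrakk>U \<in> carrier (C \<alpha>); V \<in> carrier (C (\<gamma> - \<alpha>))\<rbrakk> \<Longrightarrow> cmul \<gamma> U V \<in> carrier (C \<gamma>)"
  using GE_GE_mult[of _ \<alpha> _ "\<gamma> - \<alpha>"] by (elim CE) (auto simp: cm intro!: H_C)

lemma cmul_add_l: "\<lbrakk>U \<in> carrier (C \<alpha>); U' \<in> carrier (C \<alpha>); V \<in> carrier (C (\<gamma> - \<alpha>))\<rbrakk>
   \<Longrightarrow> cmul \<gamma> (U \<otimes>\<^bsub>C \<alpha>\<^esub> U') V = cmul \<gamma> U V \<otimes>\<^bsub>C \<gamma>\<^esub> cmul \<gamma> U' V"
  using GE_GE_mult[of _ \<alpha> _ "\<gamma> - \<alpha>"]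
  by (elim CE) (auto simp: cm C_mult GE_add GE_carr l_distr)

lemma cmul_add_r: "\<lbrakk>U \<in> carrier (C \<alpha>); V \<in> carrier (C (\<gamma> - \<alpha>)); V' \<in> carrier (C (\<gamma> - \<alpha>))\<rbrakk>
   \<Longrightarrow> cmul \<gamma> U (V \<otimes>\<^bsub>C (\<gamma> - \<alpha>)\<^esub> V') = cmul \<gamma> U V \<otimes>\<^bsub>C \<gamma>\<^esub> cmul \<gamma> U V'"
  using GE_GE_mult[of _ \<alpha> _ "\<gamma> - \<alpha>"]
  by (elim CE) (auto simp: cm C_mult GE_add GE_carr r_distr)

lemma cmul_zero_l: "V \<in> carrier (C (\<gamma> - \<alpha>)) \<Longrightarrow> cmul \<gamma> (GT \<alpha>) V = GT \<gamma>"
  using cm[of \<zero> \<alpha> _ \<gamma>] by (elim CE) (auto simp: GE_zero H_zero GE_carr)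
lemma cmul_zero_r: "U \<in> carrier (C \<alpha>) \<Longrightarrow> cmul \<gamma> U (GT (\<gamma> - \<alpha>)) = GT \<gamma>"
  using cm[of _ \<alpha> \<zero> \<gamma>] by (elim CE) (auto simp: GE_zero H_zero GE_carr)

abbreviation "G \<equiv> gr_ring F v"

lemma G_carrier: "f \<in> carrier G \<longleftrightarrow> (\<forall>\<beta>. f \<beta> \<in> carrier (C \<beta>)) \<and> finite {\<beta>. f \<beta> \<noteq> GT \<beta>}"
  unfolding gr_ring_def by (simp add: carrier_sum_group C_group C_one PiE_UNIV_domain Pi_iff)
lemma G_add: "f \<oplus>\<^bsub>G\<^esub> g = (\<lambda>\<beta>. f \<beta> \<otimes>\<^bsub>C \<beta>\<^esub> g \<beta>)" unfolding gr_ring_def by (simp add: restrict_UNIV)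
lemma G_zero: "\<zero>\<^bsub>G\<^esub> = GT" unfolding gr_ring_def by (simp add: C_one restrict_UNIV)
lemma G_one: "\<one>\<^bsub>G\<^esub> = (\<lambda>\<beta>. if \<beta> = 0 then H 0 \<one> else GT \<beta>)" unfolding gr_ring_def by simp
lemma G_mult: "f \<otimes>\<^bsub>G\<^esub> g = (\<lambda>\<gamma>. finprod (C \<gamma>) (\<lambda>\<alpha>. cmul \<gamma> (f \<alpha>) (g (\<gamma> - \<alpha>))) {\<alpha>. f \<alpha> \<noteq> GT \<alpha>})"
  unfolding gr_ring_def by simp

lemma G_comm_group: "comm_group (add_monoid G)"
proof -
  have "Group.group (sum_group UNIV C)" by (simp add: C_group)
  moreover have "x \<otimes>\<^bsub>sum_group UNIV C\<^esub> y = y \<otimes>\<^bsub>sum_group UNIV C\<^esub> x"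
    if "x \<in> carrier (sum_group UNIV C)" "y \<in> carrier (sum_group UNIV C)" for x y
  proof -
    have "x i \<otimes>\<^bsub>C i\<^esub> y i = y i \<otimes>\<^bsub>C i\<^esub> x i" for i
      using that by (intro comm_groupE(4)[OF C_comm_group]) (auto simp: carrier_sum_group C_group)
    thus ?thesis by simp
  qed
  ultimately have c: "comm_group (sum_group UNIV C)" by (rule group.group_comm_groupI)
  have e: "carrier (add_monoid G) = carrier (sum_group UNIV C)" "monoid.mult (add_monoid G) = monoid.mult (sum_group UNIV C)"
    "monoid.one (add_monoid G) = monoid.one (sum_group UNIV C)" unfolding gr_ring_def by simp_all
  show ?thesis
    by (rule comm_groupI; unfold e) (fact comm_groupE[OF c])+
qed

lemma G_mult_superset:
  assumes "f \<in> carrier G" "g \<in> carrier G" "finite A" "{\<alpha>. f \<alpha> \<noteq> GT \<alpha>} \<subseteq> A"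
  shows "(f \<otimes>\<^bsub>G\<^esub> g) \<gamma> = finprod (C \<gamma>) (\<lambda>\<alpha>. cmul \<gamma> (f \<alpha>) (g (\<gamma> - \<alpha>))) A"
  unfolding G_mult
proof (rule comm_monoid.finprod_mono_neutral_cong_left)
  show "Group.comm_monoid (C \<gamma>)" using C_comm_group comm_group.axioms(1) by blast
qed (use assms in \<open>auto simp: G_carrier C_one intro!: cmul_closed cmul_zero_l\<close>)

lemma C_cm: "Group.comm_monoid (C \<beta>)" using C_comm_group comm_group.axioms(1) by blast
lemma C_m: "Group.monoid (C \<beta>)" using C_cm Group.comm_monoid.axioms(1) by blast

lemma finprod_single: "k \<alpha> \<in> carrier (C \<gamma>) \<Longrightarrow> finprod (C \<gamma>) k {\<alpha>} = k \<alpha>"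
  using comm_monoid.finprod_insert[OF C_cm, of "{}" \<alpha> k \<gamma>]
  by (simp add: comm_monoid.finprod_empty[OF C_cm] monoid.r_one[OF C_m])

definition homog where "homog \<beta> y \<equiv> (\<lambda>\<alpha>. if \<alpha> = \<beta> then H \<beta> y else GT \<alpha>)"

lemma homog_closed: "y \<in> GE \<beta> \<Longrightarrow> homog \<beta> y \<in> carrier G"
proof -
  assume y: "y \<in> GE \<beta>"
  have "{\<alpha>. homog \<beta> y \<alpha> \<noteq> GT \<alpha>} \<subseteq> {\<beta>}" unfolding homog_def by auto
  thus ?thesis using y finite_subset by (auto simp: G_carrier homog_def H_C GT_in_C)
qed

lemma homog_mult: assumes y: "y \<in> GE \<alpha>" and z: "z \<in> GE \<beta>"
  shows "homog \<alpha> y \<otimes>\<^bsub>G\<^esub> homog \<beta> z = homog (\<alpha> + \<beta>) (y \<otimes> z)"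
proof
  fix \<gamma>
  have "(homog \<alpha> y \<otimes>\<^bsub>G\<^esub> homog \<beta> z) \<gamma> = finprod (C \<gamma>) (\<lambda>\<delta>. cmul \<gamma> (homog \<alpha> y \<delta>) (homog \<beta> z (\<gamma> - \<delta>))) {\<alpha>}"
    by (rule G_mult_superset) (use y z in \<open>auto simp: homog_closed, auto simp: homog_def\<close>)
  also have "\<dots> = cmul \<gamma> (homog \<alpha> y \<alpha>) (homog \<beta> z (\<gamma> - \<alpha>))"
    by (rule finprod_single) (use homog_closed[OF y] homog_closed[OF z] in \<open>auto simp: G_carrier intro!: cmul_closed\<close>)
  also have "\<dots> = homog (\<alpha> + \<beta>) (y \<otimes> z) \<gamma>"
    using y z cm[of y \<alpha> z \<gamma>] cmul_zero_r[of "H \<alpha> y" \<alpha> \<gamma>]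
    by (auto simp: homog_def H_C algebra_simps)
  finally show "(homog \<alpha> y \<otimes>\<^bsub>G\<^esub> homog \<beta> z) \<gamma> = homog (\<alpha> + \<beta>) (y \<otimes> z) \<gamma>" .
qed


lemma G_closed: assumes f: "f \<in> carrier G" and g: "g \<in> carrier G" shows "f \<otimes>\<^bsub>G\<^esub> g \<in> carrier G"
proof -
  define S where "S = (\<lambda>f. {\<alpha>. f \<alpha> \<noteq> GT \<alpha>})"
  have fin: "finite (S f)" "finite (S g)" using f g by (auto simp: G_carrier S_def)
  have c: "cmul \<gamma> (f \<alpha>) (g (\<gamma> - \<alpha>)) \<in> carrier (C \<gamma>)" for \<alpha> \<gamma>
    using f g by (auto simp: G_carrier intro!: cmul_closed)
  have "(f \<otimes>\<^bsub>G\<^esub> g) \<gamma> = GT \<gamma>" if "\<gamma> \<notin> (\<lambda>(a, b). a + b) ` (S f \<times> S g)" for \<gamma>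
  proof -
    have "cmul \<gamma> (f \<alpha>) (g (\<gamma> - \<alpha>)) = \<one>\<^bsub>C \<gamma>\<^esub>" if "\<alpha> \<in> S f" for \<alpha>
    proof -
      have "\<gamma> - \<alpha> \<notin> S g" 
      proof
        assume "\<gamma> - \<alpha> \<in> S g"
        hence "(\<lambda>(a, b). a + b) (\<alpha>, \<gamma> - \<alpha>) \<in> (\<lambda>(a, b). a + b) ` (S f \<times> S g)" using that by (intro imageI) simp
        thus False using \<open>\<gamma> \<notin> _\<close> by simp
      qed
      thus ?thesis using f cmul_zero_r[of "f \<alpha>" \<alpha> \<gamma>] by (auto simp: S_def C_one G_carrier)
    qed
    hence "finprod (C \<gamma>) (\<lambda>\<alpha>. cmul \<gamma> (f \<alpha>) (g (\<gamma> - \<alpha>))) (S f) = \<one>\<^bsub>C \<gamma>\<^esub>"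
      by (rule comm_monoid.finprod_one_eqI[OF C_cm])
    thus ?thesis unfolding G_mult S_def C_one .
  qed
  hence "{\<gamma>. (f \<otimes>\<^bsub>G\<^esub> g) \<gamma> \<noteq> GT \<gamma>} \<subseteq> (\<lambda>(a, b). a + b) ` (S f \<times> S g)" by blast
  hence "finite {\<gamma>. (f \<otimes>\<^bsub>G\<^esub> g) \<gamma> \<noteq> GT \<gamma>}" by (rule finite_subset) (use fin in auto)
  moreover have "(f \<otimes>\<^bsub>G\<^esub> g) \<gamma> \<in> carrier (C \<gamma>)" for \<gamma>
    unfolding G_mult by (rule comm_monoid.finprod_closed[OF C_cm]) (simp add: c)
  ultimately show ?thesis unfolding G_carrier by blast
qed

lemma G_add_closed: "\<lbrakk>f \<in> carrier G; g \<in> carrier G\<rbrakk> \<Longrightarrow> f \<oplus>\<^bsub>G\<^esub> g \<in> carrier G"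
  proof -
  assume "f \<in> carrier G" "g \<in> carrier G"
  hence "f \<in> carrier (add_monoid G)" "g \<in> carrier (add_monoid G)" by simp_all
  from comm_groupE(1)[OF G_comm_group this] show ?thesis by simp
qed

lemma G_l_distr: assumes "f \<in> carrier G" "f' \<in> carrier G" "g \<in> carrier G"
  shows "(f \<oplus>\<^bsub>G\<^esub> f') \<otimes>\<^bsub>G\<^esub> g = f \<otimes>\<^bsub>G\<^esub> g \<oplus>\<^bsub>G\<^esub> f' \<otimes>\<^bsub>G\<^esub> g"
proof
  fix \<gamma>
  define A where "A = {\<alpha>. f \<alpha> \<noteq> GT \<alpha>} \<union> {\<alpha>. f' \<alpha> \<noteq> GT \<alpha>}"
  have A: "finite A" using assms by (auto simp: A_def G_carrier)
  have "(f \<oplus>\<^bsub>G\<^esub> f') \<alpha> = GT \<alpha>" if "f \<alpha> = GT \<alpha>" "f' \<alpha> = GT \<alpha>" for \<alpha>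
    using that monoid.r_one[OF C_m, of "GT \<alpha>" \<alpha>] GT_in_C[of \<alpha>] by (simp add: G_add C_one)
  hence sub: "{\<alpha>. (f \<oplus>\<^bsub>G\<^esub> f') \<alpha> \<noteq> GT \<alpha>} \<subseteq> A" by (auto simp: A_def)
  have "((f \<oplus>\<^bsub>G\<^esub> f') \<otimes>\<^bsub>G\<^esub> g) \<gamma> = finprod (C \<gamma>) (\<lambda>\<alpha>. cmul \<gamma> ((f \<oplus>\<^bsub>G\<^esub> f') \<alpha>) (g (\<gamma> - \<alpha>))) A"
    by (rule G_mult_superset) (use assms A sub in \<open>auto intro!: G_add_closed\<close>)
  also have "\<dots> = finprod (C \<gamma>) (\<lambda>\<alpha>. cmul \<gamma> (f \<alpha>) (g (\<gamma> - \<alpha>)) \<otimes>\<^bsub>C \<gamma>\<^esub> cmul \<gamma> (f' \<alpha>) (g (\<gamma> - \<alpha>))) A"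
    using assms cmul_add_l[of "f \<alpha>" \<alpha> "f' \<alpha>" "g (\<gamma> - \<alpha>)" \<gamma> for \<alpha>] by (simp add: G_add G_carrier)
  also have "\<dots> = finprod (C \<gamma>) (\<lambda>\<alpha>. cmul \<gamma> (f \<alpha>) (g (\<gamma> - \<alpha>))) A \<otimes>\<^bsub>C \<gamma>\<^esub> finprod (C \<gamma>) (\<lambda>\<alpha>. cmul \<gamma> (f' \<alpha>) (g (\<gamma> - \<alpha>))) A"
    by (rule comm_monoid.finprod_multf[OF C_cm]) (use assms in \<open>auto simp: G_carrier intro!: cmul_closed\<close>)
  also have "\<dots> = (f \<otimes>\<^bsub>G\<^esub> g) \<gamma> \<otimes>\<^bsub>C \<gamma>\<^esub> (f' \<otimes>\<^bsub>G\<^esub> g) \<gamma>"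
    using assms A G_mult_superset[of f g A \<gamma>] G_mult_superset[of f' g A \<gamma>] by (auto simp: A_def)
  finally show "((f \<oplus>\<^bsub>G\<^esub> f') \<otimes>\<^bsub>G\<^esub> g) \<gamma> = (f \<otimes>\<^bsub>G\<^esub> g \<oplus>\<^bsub>G\<^esub> f' \<otimes>\<^bsub>G\<^esub> g) \<gamma>" by (simp add: G_add)
qed

lemma G_r_distr: assumes "f \<in> carrier G" "g \<in> carrier G" "g' \<in> carrier G"
  shows "f \<otimes>\<^bsub>G\<^esub> (g \<oplus>\<^bsub>G\<^esub> g') = f \<otimes>\<^bsub>G\<^esub> g \<oplus>\<^bsub>G\<^esub> f \<otimes>\<^bsub>G\<^esub> g'"
proof
  fix \<gamma>
  let ?A = "{\<alpha>. f \<alpha> \<noteq> GT \<alpha>}"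
  have "(f \<otimes>\<^bsub>G\<^esub> (g \<oplus>\<^bsub>G\<^esub> g')) \<gamma> = finprod (C \<gamma>) (\<lambda>\<alpha>. cmul \<gamma> (f \<alpha>) (g (\<gamma> - \<alpha>)) \<otimes>\<^bsub>C \<gamma>\<^esub> cmul \<gamma> (f \<alpha>) (g' (\<gamma> - \<alpha>))) ?A"
    using assms cmul_add_r[of "f \<alpha>" \<alpha> "g (\<gamma> - \<alpha>)" \<gamma> "g' (\<gamma> - \<alpha>)" for \<alpha>] by (simp add: G_mult G_add G_carrier)
  also have "\<dots> = (f \<otimes>\<^bsub>G\<^esub> g) \<gamma> \<otimes>\<^bsub>C \<gamma>\<^esub> (f \<otimes>\<^bsub>G\<^esub> g') \<gamma>"
    unfolding G_mult
    by (rule comm_monoid.finprod_multf[OF C_cm]) (use assms in \<open>auto simp: G_carrier intro!: cmul_closed\<close>)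
  finally show "(f \<otimes>\<^bsub>G\<^esub> (g \<oplus>\<^bsub>G\<^esub> g')) \<gamma> = (f \<otimes>\<^bsub>G\<^esub> g \<oplus>\<^bsub>G\<^esub> f \<otimes>\<^bsub>G\<^esub> g') \<gamma>" by (simp add: G_add)
qed

lemma homog_zero: "homog \<beta> \<zero> = \<zero>\<^bsub>G\<^esub>" by (simp add: homog_def G_zero H_zero fun_eq_iff)

lemma G_induct [consumes 1, case_names homog add]:
  assumes f: "f \<in> carrier G"
    and h: "\<And>\<beta> y. y \<in> GE \<beta> \<Longrightarrow> P (homog \<beta> y)"
    and a: "\<And>f g. \<lbrakk>f \<in> carrier G; g \<in> carrier G; P f; P g\<rbrakk> \<Longrightarrow> P (f \<oplus>\<^bsub>G\<^esub> g)"
  shows "P f"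
proof -
  have "finite A \<Longrightarrow> f \<in> carrier G \<Longrightarrow> {\<alpha>. f \<alpha> \<noteq> GT \<alpha>} \<subseteq> A \<Longrightarrow> P f" for A f
  proof (induction A arbitrary: f rule: finite_induct)
    case empty
    hence "f = homog 0 \<zero>" by (auto simp: homog_zero G_zero)
    thus ?case using h GE_zero by metis
  next
    case (insert \<beta> A)
    then obtain y where y: "y \<in> GE \<beta>" "f \<beta> = H \<beta> y" by (meson CE G_carrier)
    define g where "g = f(\<beta> := GT \<beta>)"
    have "{\<alpha>. g \<alpha> \<noteq> GT \<alpha>} \<subseteq> {\<alpha>. f \<alpha> \<noteq> GT \<alpha>}" by (auto simp: g_def)
    moreover have "finite {\<alpha>. f \<alpha> \<noteq> GT \<alpha>}" using insert.prems(1) by (simp add: G_carrier)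
    ultimately have "finite {\<alpha>. g \<alpha> \<noteq> GT \<alpha>}" by (rule finite_subset)
    moreover have "\<forall>\<alpha>. g \<alpha> \<in> carrier (C \<alpha>)" using insert.prems(1) by (simp add: G_carrier GT_in_C g_def)
    ultimately have g: "g \<in> carrier G" unfolding G_carrier by blast
    have "P g" using insert.prems by (intro insert.IH g) (auto simp: g_def)
    moreover have "f = homog \<beta> y \<oplus>\<^bsub>G\<^esub> g"
    proof
      fix \<alpha>
      show "f \<alpha> = (homog \<beta> y \<oplus>\<^bsub>G\<^esub> g) \<alpha>"
        using y H_C[OF y(1)] insert.prems(1) monoid.r_one[OF C_m, of "f \<alpha>" \<alpha>] monoid.l_one[OF C_m, of "f \<alpha>" \<alpha>]
        by (auto simp: G_add g_def homog_def C_one G_carrier)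
    qed
    ultimately show ?case using a[OF homog_closed[OF y(1)] g h[OF y(1)]] by simp
  qed
  thus ?thesis using f by (auto simp: G_carrier)
qed

lemma G_comm: assumes "f \<in> carrier G" "g \<in> carrier G" shows "f \<otimes>\<^bsub>G\<^esub> g = g \<otimes>\<^bsub>G\<^esub> f"
  using assms
proof (induction f rule: G_induct)
  case (homog \<beta> y)
  from \<open>g \<in> carrier G\<close> show ?case
    by (induction g rule: G_induct)
      (use homog in \<open>simp_all add: homog_mult G_l_distr G_r_distr homog_closed add.commute m_comm GE_carr\<close>)
qed (simp add: G_l_distr G_r_distr)

lemma G_assoc: assumes "f \<in> carrier G" "g \<in> carrier G" "h \<in> carrier G"
  shows "(f \<otimes>\<^bsub>G\<^esub> g) \<otimes>\<^bsub>G\<^esub> h = f \<otimes>\<^bsub>G\<^esub> (g \<otimes>\<^bsub>G\<^esub> h)"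
  using assms
proof (induction f rule: G_induct)
  case (homog \<beta> y)
  from \<open>g \<in> carrier G\<close> show ?case
  proof (induction g rule: G_induct)
    case (homog \<gamma> z)
    from \<open>h \<in> carrier G\<close> show ?case
      by (induction h rule: G_induct)
        (use homog \<open>y \<in> GE \<beta>\<close> in \<open>simp_all add: homog_mult G_r_distr G_closed homog_closed add.assoc m_assoc GE_carr GE_GE_mult\<close>)
  qed (use homog in \<open>simp_all add: G_l_distr G_r_distr homog_closed G_closed\<close>)
qed (simp add: G_l_distr G_closed)

lemma one_GE: "\<one> \<in> GE 0" by (simp add: GE_iff v_one)
lemma G_one_homog: "\<one>\<^bsub>G\<^esub> = homog 0 \<one>" by (auto simp: G_one homog_def)

theorem G_cring: "cring G"
proof (intro cringI)
  show "abelian_group G" unfolding abelian_group_def abelian_monoid_def abelian_group_axioms_def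
    using G_comm_group by (simp add: comm_group.axioms(1))
  show "Group.comm_monoid G"
  proof (rule comm_monoidI)
    show "\<one>\<^bsub>G\<^esub> \<in> carrier G" by (simp add: G_one_homog homog_closed one_GE)
    show "\<one>\<^bsub>G\<^esub> \<otimes>\<^bsub>G\<^esub> f = f" if "f \<in> carrier G" for f
      using that by (induction f rule: G_induct)
        (simp_all add: G_one_homog homog_mult one_GE GE_carr G_r_distr homog_closed)
  qed (fact G_closed G_assoc G_comm)+
qed (simp add: G_l_distr)

lemma initial_form_homog: "initial_form F v y = homog (v y) y" unfolding initial_form_def homog_def by (simp add: fun_eq_iff)

lemma initial_form_zero: "initial_form F v \<zero> = \<zero>\<^bsub>G\<^esub>" by (simp add: initial_form_homog homog_zero)

lemma initial_form_mult: "\<lbrakk>y \<in> carrier F; z \<in> carrier F; y \<noteq> \<zero>; z \<noteq> \<zero>\<rbrakk> \<Longrightarrow>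
  initial_form F v (y \<otimes> z) = initial_form F v y \<otimes>\<^bsub>G\<^esub> initial_form F v z"
  by (simp add: initial_form_homog homog_mult GE_iff v_mult)

lemma initial_form_nonzero: "\<lbrakk>y \<in> carrier F; y \<noteq> \<zero>\<rbrakk> \<Longrightarrow> initial_form F v y \<noteq> \<zero>\<^bsub>G\<^esub>"
  using self_H[of y "v y"] by (auto simp: initial_form_homog homog_def G_zero fun_eq_iff GT_iff)

end

lemma gr_map_initial_form:
  fixes L (structure)
  assumes L: "field L" and K: "subfield K L" and v: "valuation (L\<lparr>carrier := K\<rparr>) v"
    and i: "ordered_group_embedding \<iota>" and w: "extends_valuation L K v \<iota> w" and y: "y \<in> K" "y \<noteq> \<zero>"
  shows "gr_map L \<iota> w (initial_form (L\<lparr>carrier := K\<rparr>) v y) = initial_form L w y"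
proof -
  interpret LL: valued_field L w using L w by (simp add: valued_field_def valued_field_axioms_def extends_valuation_def)
  have KL: "K \<subseteq> carrier L" using K by (simp add: subfieldE(3))
  interpret KK: valued_field "L\<lparr>carrier := K\<rparr>" v
    using LL.subfield_iff(2)[OF K] v by (simp add: valued_field_def valued_field_axioms_def)
  have inj: "inj \<iota>" using i by (simp add: ordered_group_embedding_def strict_mono_imp_inj_on)
  have wy: "w k = \<iota> (v k)" if "k \<in> K" "k \<noteq> \<zero>" for k using w that by (auto simp: extends_valuation_def)
  have less: "\<iota> \<alpha> < \<iota> \<beta> \<longleftrightarrow> \<alpha> < \<beta>" for \<alpha> \<beta> using i by (simp add: ordered_group_embedding_def strict_mono_less)
  have GTs: "KK.GT \<beta> \<subseteq> LL.GT (\<iota> \<beta>)" for \<beta> using KL wy by (auto simp: val_gt_def less)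
  have a: "LL.GT (\<iota> \<beta>) <+> KK.GT \<beta> = LL.GT (\<iota> \<beta>)" for \<beta>
  proof
    show "LL.GT (\<iota> \<beta>) <+> KK.GT \<beta> \<subseteq> LL.GT (\<iota> \<beta>)" using subsetD[OF GTs[of \<beta>]] LL.GT_add by (auto simp: set_add_def set_mult_def)
    show "LL.GT (\<iota> \<beta>) \<subseteq> LL.GT (\<iota> \<beta>) <+> KK.GT \<beta>" using KK.GT_zero[of \<beta>] LL.GT_carr
      by (force simp: set_add_def set_mult_def)
  qed
  have b: "LL.GT (\<iota> \<beta>) <+> (KK.GT \<beta> +>\<^bsub>L\<lparr>carrier := K\<rparr>\<^esub> y) = LL.GT (\<iota> \<beta>) +> y" for \<beta>
  proof -
    have "LL.GT (\<iota> \<beta>) <+> (KK.GT \<beta> +>\<^bsub>L\<lparr>carrier := K\<rparr>\<^esub> y) = (LL.GT (\<iota> \<beta>) <+> KK.GT \<beta>) +> y"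
    proof -
      have "h \<oplus> (k \<oplus> y) = (h \<oplus> k) \<oplus> y" if "h \<in> LL.GT (\<iota> \<beta>)" "k \<in> KK.GT \<beta>" for h k
        using that LL.GT_carr GTs y KL by (metis LL.add.m_assoc subsetD)
      thus ?thesis by (fastforce simp: set_add_def set_mult_def a_r_coset_def r_coset_def)
    qed
    thus ?thesis using a by simp
  qed
  show ?thesis
    unfolding gr_map_def initial_form_def using y wy inj a b by (auto simp: fun_eq_iff inj_eq)
qed
end

theory Submission
  imports Defs
begin

text \<open>
  Write \<open>w\<close> for the given extension and \<open>c\<^sub>0, \<dots>, c\<^sub>n\<close> for the coefficients of the
  minimal polynomial of \<open>x\<close>, with \<open>c\<^sub>n = 1\<close>; suppose \<open>x \<noteq> 0\<close>. If all terms of a polynomial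
  expression \<open>\<Sum> a\<^sub>i x\<^sup>i\<close> have value at least \<open>\<beta>\<close>, some of them value exactly \<open>\<beta>\<close>, while the sum has
  value greater than \<open>\<beta>\<close>, then the terms of value \<open>\<beta>\<close> give a relation satisfied by the initial form
  of \<open>x\<close>, so one of them must have degree at least \<open>n\<close> (\<open>high_term_in_relation\<close>). This has two consequences.

  First, \<open>w (\<Sum>i<n. a\<^sub>i x\<^sup>i)\<close> is the minimum of the values of the terms
  (\<open>low_degree_value\<close>). Every element of \<open>L\<close> is such a sum, so \<open>w\<close> is known once
  \<open>w x\<close> is.

  Second, the relation \<open>\<Sum> c\<^sub>i x\<^sup>i = 0\<close> has its minimal value at \<open>x\<^sup>n\<close> and, because one may divide
  by \<open>x\<close>, also at \<open>c\<^sub>0\<close>: the Newton polygon of the minimal polynomial is a single segment. This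
  is a statement about the values of the \<open>c\<^sub>i\<close> alone, so it forces \<open>n u(x) = u(c\<^sub>0)\<close> for every
  extension \<open>u\<close> of the valuation of \<open>K\<close> (\<open>generator_value_other\<close>).

  Any valuation of a sum is at least the minimum of the values of the terms, so \<open>u y\<close> is at least
  \<open>w y\<close> for all \<open>y\<close>, in the sense that \<open>n w(y)\<close> and \<open>n u(y)\<close> can be compared through the value group of
  \<open>K\<close> (\<open>value_le_other\<close>). The same inequality for \<open>1 / y\<close> is the reverse one for \<open>y\<close>; hence
  \<open>n w(y)\<close> and \<open>n u(y)\<close> are the images of one element of that group (\<open>value_determined\<close>).
  Ordered groups are torsion-free, so this determines \<open>u\<close>. If \<open>x = 0\<close>, then \<open>L = K\<close>.
\<close>

section \<open>Multiples in ordered groups\<close>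

primrec nmul :: "nat \<Rightarrow> 'g::linordered_ab_group_add \<Rightarrow> 'g" (infixr \<open>\<bullet>\<close> 75) where
  "0 \<bullet> a = 0"
| "Suc n \<bullet> a = a + n \<bullet> a"

lemma nmul_add_right: "n \<bullet> (a + b) = n \<bullet> a + n \<bullet> b"
  by (induction n) (simp_all add: ac_simps)

lemma nmul_add_left: "(m + n) \<bullet> a = m \<bullet> a + n \<bullet> a"
  by (induction m) (simp_all add: ac_simps)

lemma nmul_zero_right [simp]: "n \<bullet> 0 = 0"
  by (induction n) simp_all

lemma nmul_commute: "m \<bullet> n \<bullet> a = n \<bullet> m \<bullet> a"
  by (induction m) (simp_all add: nmul_add_right)

lemma nmul_uminus: "n \<bullet> (- a) = - (n \<bullet> a)"
  by (induction n) simp_all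

lemma nmul_strict_mono: "a < b \<Longrightarrow> 0 < n \<Longrightarrow> n \<bullet> a < n \<bullet> b"
proof (induction n)
  case (Suc n)
  then show ?case by (cases n) (auto intro: add_strict_mono)
qed simp

lemma nmul_less_iff: "0 < n \<Longrightarrow> n \<bullet> a < n \<bullet> b \<longleftrightarrow> a < b"
  by (metis nmul_strict_mono less_asym linorder_neqE)

lemma nmul_le_iff: "0 < n \<Longrightarrow> n \<bullet> a \<le> n \<bullet> b \<longleftrightarrow> a \<le> b"
  by (simp add: nmul_less_iff flip: not_less)

lemma nmul_eq_iff: "0 < n \<Longrightarrow> n \<bullet> a = n \<bullet> b \<longleftrightarrow> a = b"
  by (metis nmul_le_iff order.antisym order.refl)

context
  fixes \<iota> :: "'g::linordered_ab_group_add \<Rightarrow> 'h::linordered_ab_group_add"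
  assumes emb: "ordered_group_embedding \<iota>"
begin

lemma emb_add: "\<iota> (a + b) = \<iota> a + \<iota> b"
  using emb by (simp add: ordered_group_embedding_def)

lemma emb_le_iff: "\<iota> a \<le> \<iota> b \<longleftrightarrow> a \<le> b"
  using emb by (simp add: ordered_group_embedding_def strict_mono_less_eq)

lemma emb_eq_iff: "\<iota> a = \<iota> b \<longleftrightarrow> a = b"
  by (metis emb_le_iff order.antisym order.refl)

lemma emb_zero: "\<iota> 0 = 0"
  using emb_add[of 0 0] by simp

lemma emb_uminus: "\<iota> (- a) = - \<iota> a"
  by (metis add.right_inverse add_eq_0_iff emb_add emb_zero)

lemma emb_nmul: "\<iota> (n \<bullet> a) = n \<bullet> \<iota> a"
  by (induction n) (simp_all add: emb_zero emb_add)

end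


section \<open>Values of polynomial expressions\<close>

lemma (in ring) coeff_in_set: "i < length p \<Longrightarrow> coeff p i \<in> set p"
  by (induction p) (auto simp: less_Suc_eq)

context valued_field
begin

lemma v_pow: "x \<in> carrier F \<Longrightarrow> x \<noteq> \<zero> \<Longrightarrow> x [^] i \<noteq> \<zero> \<and> v (x [^] i) = i \<bullet> v x"
  by (induction i) (auto simp: v_one v_mult integral_iff add.commute)

lemma v_term:
  assumes "x \<in> carrier F" "x \<noteq> \<zero>" "a \<in> carrier F" "a \<noteq> \<zero>"
  shows "a \<otimes> x [^] i \<noteq> \<zero> \<and> v (a \<otimes> x [^] i) = v a + i \<bullet> v x"
  using assms v_pow[of x i] by (auto simp: v_mult integral_iff)

lemma term_GE_iff:
  assumes "x \<in> carrier F" "x \<noteq> \<zero>" "a \<in> carrier F"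
  shows "a \<otimes> x [^] i \<in> GE \<beta> \<longleftrightarrow> a \<in> GE (\<beta> - i \<bullet> v x)"
  using assms v_term[of x a i] by (cases "a = \<zero>") (auto simp: GE_iff diff_le_eq)

lemma term_GT_iff:
  assumes "x \<in> carrier F" "x \<noteq> \<zero>" "a \<in> carrier F"
  shows "a \<otimes> x [^] i \<in> GT \<beta> \<longleftrightarrow> a \<in> GT (\<beta> - i \<bullet> v x)"
  using assms v_term[of x a i] by (cases "a = \<zero>") (auto simp: GT_iff diff_less_eq)

lemma eval_GE:
  assumes "x \<in> carrier F" "set p \<subseteq> carrier F"
    and "\<And>i. i < length p \<Longrightarrow> coeff p i \<otimes> x [^] i \<in> GE \<beta>"
  shows "eval p x \<in> GE \<beta>"
  using assms(2,3)
proof (induction p)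
  case (Cons a p)
  have "coeff p i \<otimes> x [^] i \<in> GE \<beta>" if "i < length p" for i
    using Cons.prems(2)[of i] that by simp
  with Cons have "eval p x \<in> GE \<beta>" by simp
  moreover have "a \<otimes> x [^] length p \<in> GE \<beta>"
    using Cons.prems(2)[of "length p"] by simp
  ultimately show ?case by (simp add: GE_add)
qed (simp add: GE_zero)

text \<open>
  The value at zero is arbitrary, so zero terms have to be excluded before a term of minimal value
  can be chosen; \<open>GT\<close> contains zero, and the second conclusion records the exclusion.
\<close>

lemma minimal_term:
  assumes x: "x \<in> carrier F" "x \<noteq> \<zero>" and p: "set p \<subseteq> carrier F"
    and ex: "\<exists>i < length p. coeff p i \<noteq> \<zero>"
  obtains i where "i < length p" "coeff p i \<otimes> x [^] i \<notin> GT (v (coeff p i \<otimes> x [^] i))"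
    "\<And>j. j < length p \<Longrightarrow> coeff p j \<otimes> x [^] j \<in> GE (v (coeff p i \<otimes> x [^] i))"
proof -
  define S where "S = {i. i < length p \<and> coeff p i \<noteq> \<zero>}"
  have "finite S" "S \<noteq> {}" using ex by (auto simp: S_def)
  note arg_min = arg_min_if_finite[OF this, of "\<lambda>j. v (coeff p j \<otimes> x [^] j)"]
  define i where "i = arg_min_on (\<lambda>j. v (coeff p j \<otimes> x [^] j)) S"
  have i: "i \<in> S" using arg_min(1) by (simp add: i_def)
  have min: "v (coeff p i \<otimes> x [^] i) \<le> v (coeff p j \<otimes> x [^] j)" if "j \<in> S" for j
    using arg_min(2) that unfolding i_def by (meson not_less)
  have c: "coeff p j \<in> carrier F" for j using coeff_in_carrier[OF p] .
  show ?thesis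
  proof
    show "i < length p" "coeff p i \<otimes> x [^] i \<notin> GT (v (coeff p i \<otimes> x [^] i))"
      using i v_term[OF x c] by (auto simp: S_def GT_iff)
    show "coeff p j \<otimes> x [^] j \<in> GE (v (coeff p i \<otimes> x [^] i))" if "j < length p" for j
      using that x c min[of j] by (cases "coeff p j = \<zero>") (auto simp: GE_iff S_def)
  qed
qed

lemma eval_congruent_term:
  assumes "x \<in> carrier F" "set p \<subseteq> carrier F"
    and "\<And>i. i < length p \<Longrightarrow> i \<noteq> j \<Longrightarrow> coeff p i \<otimes> x [^] i \<in> GT \<beta>"
  shows "\<exists>r \<in> GT \<beta>. eval p x = r \<oplus> coeff p j \<otimes> x [^] j"
  using assms(2,3)
proof (induction p)
  case Nil
  then show ?case using assms(1) GT_zero by force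
next
  case (Cons a p)
  have c: "a \<in> carrier F" "set p \<subseteq> carrier F" using Cons.prems by auto
  have pj: "coeff p j \<otimes> x [^] j \<in> carrier F"
    using assms(1) coeff_in_carrier[OF c(2)] by simp
  have "coeff p i \<otimes> x [^] i \<in> GT \<beta>" if "i < length p" "i \<noteq> j" for i
    using Cons.prems(2)[of i] that by simp
  with Cons c obtain r where r: "r \<in> GT \<beta>" "eval p x = r \<oplus> coeff p j \<otimes> x [^] j" by auto
  show ?case
  proof (cases "j = length p")
    case True
    have "coeff p j = \<zero>" using True coeff_length by simp
    hence "eval p x = r" using r assms(1) GT_carr[OF r(1)] by simp
    then show ?thesis using True r(1) GT_carr[OF r(1)] c assms(1) by (auto simp: a_comm)
  next
    case False
    have t: "a \<otimes> x [^] length p \<in> GT \<beta>"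
      using Cons.prems(2)[of "length p"] False by simp
    have "eval (a # p) x = (a \<otimes> x [^] length p \<oplus> r) \<oplus> coeff p j \<otimes> x [^] j"
      using r pj GT_carr[OF t] GT_carr[OF r(1)] by (simp add: a_assoc)
    then show ?thesis using False GT_add[OF t r(1)] by (intro bexI[of _ "a \<otimes> x [^] length p \<oplus> r"]) auto
  qed
qed

text \<open>
  No single term of a vanishing sum can have strictly smaller value than all the others.
\<close>

lemma root_term_GT:
  assumes "x \<in> carrier F" "set p \<subseteq> carrier F" "eval p x = \<zero>"
    and "\<And>i. i < length p \<Longrightarrow> i \<noteq> j \<Longrightarrow> coeff p i \<otimes> x [^] i \<in> GT \<beta>"
  shows "coeff p j \<otimes> x [^] j \<in> GT \<beta>"
proof -
  obtain r where r: "r \<in> GT \<beta>" "\<zero> = r \<oplus> coeff p j \<otimes> x [^] j"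
    using eval_congruent_term[OF assms(1,2,4)] assms(3) by auto
  have "coeff p j \<otimes> x [^] j \<in> carrier F"
    using assms(1) coeff_in_carrier[OF assms(2)] by simp
  hence "coeff p j \<otimes> x [^] j = \<ominus> r"
    using r GT_carr[OF r(1)] by (metis a_comm minus_equality)
  thus ?thesis using GT_neg[OF r(1)] by simp
qed


section \<open>Initial parts of polynomials\<close>

lemma homog_add:
  assumes "y \<in> GE \<beta>" "z \<in> GE \<beta>"
  shows "homog \<beta> y \<oplus>\<^bsub>G\<^esub> homog \<beta> z = homog \<beta> (y \<oplus> z)"
  using assms monoid.l_one[OF C_m GT_in_C]
  by (auto simp: G_add homog_def C_mult C_one fun_eq_iff)

lemma homog_eq_zero_iff:
  assumes "y \<in> GE \<beta>"
  shows "homog \<beta> y = \<zero>\<^bsub>G\<^esub> \<longleftrightarrow> y \<in> GT \<beta>"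
proof
  assume "homog \<beta> y = \<zero>\<^bsub>G\<^esub>"
  hence "homog \<beta> y \<beta> = GT \<beta>" by (simp add: G_zero)
  hence "H \<beta> y = GT \<beta>" by (simp add: homog_def)
  thus "y \<in> GT \<beta>" using self_H[OF GE_carr[OF assms]] by auto
next
  assume "y \<in> GT \<beta>"
  hence "y \<in> H \<beta> \<zero>" by (simp add: H_zero)
  hence "H \<beta> y = GT \<beta>" using H_eqI[OF _ GE_zero] H_zero by simp
  thus "homog \<beta> y = \<zero>\<^bsub>G\<^esub>" by (auto simp: homog_def G_zero fun_eq_iff)
qed

lemma initial_form_pow:
  assumes "x \<in> carrier F" "x \<noteq> \<zero>"
  shows "initial_form F v x [^]\<^bsub>G\<^esub> (i::nat) = homog (i \<bullet> v x) (x [^] i)"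
proof (induction i)
  case 0
  show ?case by (simp add: G_one_homog)
next
  case (Suc i)
  have "x [^] i \<in> GE (i \<bullet> v x)" "x \<in> GE (v x)"
    using assms v_pow[of x i] by (auto simp: GE_iff)
  then show ?case
    using Suc by (simp add: initial_form_homog homog_mult add.commute)
qed

text \<open>
  The part of value \<open>\<beta>\<close> of a polynomial in an element of value \<open>\<gamma>\<close>. When the
  coefficient of degree \<open>i\<close> has value at least \<open>\<beta> - i \<bullet> \<gamma>\<close>, its class in that degree is its initial
  form if equality holds and zero otherwise; no case distinction is needed. The leading
  entries may vanish, so the list has to be normalised to be a polynomial.
\<close>

primrec initial_poly :: "'g \<Rightarrow> 'g \<Rightarrow> 'a list \<Rightarrow> ('g \<Rightarrow> 'a set) list" where
  "initial_poly \<beta> \<gamma> [] = []"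
| "initial_poly \<beta> \<gamma> (a # p) = homog (\<beta> - length p \<bullet> \<gamma>) a # initial_poly \<beta> \<gamma> p"

lemma length_initial_poly [simp]: "length (initial_poly \<beta> \<gamma> p) = length p"
  by (induction p) simp_all

lemma coeff_initial_poly:
  "i < length p \<Longrightarrow> ring.coeff G (initial_poly \<beta> \<gamma> p) i = homog (\<beta> - i \<bullet> \<gamma>) (coeff p i)"
proof (induction p)
  interpret G: cring G by (rule G_cring)
  case (Cons a p)
  then show ?case by (auto simp: less_Suc_eq)
qed simp

lemma set_initial_poly:
  "set (initial_poly \<beta> \<gamma> p) \<subseteq> (\<lambda>i. homog (\<beta> - i \<bullet> \<gamma>) (coeff p i)) ` {..<length p}"
proof (induction p)
  case (Cons a p)
  have "(\<lambda>i. homog (\<beta> - i \<bullet> \<gamma>) (coeff (a # p) i)) ` {..<length (a # p)} =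
      insert (homog (\<beta> - length p \<bullet> \<gamma>) a) ((\<lambda>i. homog (\<beta> - i \<bullet> \<gamma>) (coeff p i)) ` {..<length p})"
    by (simp add: lessThan_Suc)
  with Cons show ?case by auto
qed simp

text \<open>
  All terms of the evaluated polynomial are homogeneous of the same degree \<open>\<beta>\<close>, and the
  classes in degree \<open>\<beta>\<close> add like their representatives.
\<close>

lemma eval_initial_poly:
  assumes x: "x \<in> carrier F" "x \<noteq> \<zero>" and p: "set p \<subseteq> carrier F"
    and GE: "\<And>i. i < length p \<Longrightarrow> coeff p i \<otimes> x [^] i \<in> GE \<beta>"
  shows "ring.eval G (initial_poly \<beta> (v x) p) (initial_form F v x) = homog \<beta> (eval p x)"
  using p GE
proof (induction p)
  interpret G: cring G by (rule G_cring)
  case Nil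
  show ?case by (simp add: homog_zero)
next
  interpret G: cring G by (rule G_cring)
  case (Cons a p)
  let ?t = "a \<otimes> x [^] length p"
  have a: "a \<in> carrier F" and p: "set p \<subseteq> carrier F" using Cons.prems by auto
  have t: "?t \<in> GE \<beta>" using Cons.prems(2)[of "length p"] by simp
  have GE_p: "coeff p i \<otimes> x [^] i \<in> GE \<beta>" if "i < length p" for i
    using Cons.prems(2)[of i] that by simp
  have "a \<in> GE (\<beta> - length p \<bullet> v x)" using t term_GE_iff[OF x a] by simp
  moreover have "x [^] length p \<in> GE (length p \<bullet> v x)"
    using x v_pow[of x] by (auto simp: GE_iff)
  ultimately have "homog (\<beta> - length p \<bullet> v x) a \<otimes>\<^bsub>G\<^esub> initial_form F v x [^]\<^bsub>G\<^esub> length p = homog \<beta> ?t"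
    using x by (simp add: initial_form_pow homog_mult)
  moreover have "eval p x \<in> GE \<beta>" using eval_GE[OF x(1) p GE_p] .
  ultimately show ?case
    using Cons.IH[OF p GE_p] t by (simp add: homog_add)
qed

end

section \<open>A generator whose initial form has maximal degree\<close>

locale valued_extension = valued_field L w
  for L (structure) and w :: "'a \<Rightarrow> 'h::linordered_ab_group_add" +
  fixes K :: "'a set" and v :: "'a \<Rightarrow> 'g::linordered_ab_group_add" and \<iota> :: "'g \<Rightarrow> 'h"
  assumes K: "subfield K L"
    and v: "valuation (L\<lparr>carrier := K\<rparr>) v"
    and \<iota>: "ordered_group_embedding \<iota>"
    and w_v: "y \<in> K \<Longrightarrow> y \<noteq> \<zero> \<Longrightarrow> w y = \<iota> (v y)"
begin

lemma extends: "extends_valuation L K v \<iota> w"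
  using val w_v by (simp add: extends_valuation_def)

sublocale base: valued_field "L\<lparr>carrier := K\<rparr>" v
  using subfield_iff(2)[OF K] v by (simp add: valued_field_def valued_field_axioms_def)

lemma K_sub: "K \<subseteq> carrier L" and zero_in_K: "\<zero> \<in> K"
  using subfieldE(3)[OF K] subringE(2)[OF subfieldE(1)[OF K]] by auto

lemma gr_map_zero: "gr_map L \<iota> w \<zero>\<^bsub>base.G\<^esub> = \<zero>\<^bsub>G\<^esub>"
proof -
  have less: "\<iota> a < \<iota> b \<longleftrightarrow> a < b" for a b
    using emb_le_iff[OF \<iota>] by (simp flip: not_le)
  have inj: "inj \<iota>" using emb_eq_iff[OF \<iota>] by (simp add: inj_def)
  have "GT (\<iota> \<alpha>) <+> base.GT \<alpha> = GT (\<iota> \<alpha>)" for \<alpha>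
  proof
    have "base.GT \<alpha> \<subseteq> GT (\<iota> \<alpha>)" using K_sub w_v by (auto simp: val_gt_def less)
    thus "GT (\<iota> \<alpha>) <+> base.GT \<alpha> \<subseteq> GT (\<iota> \<alpha>)"
      using GT_add by (auto simp: set_add_def set_mult_def)
    show "GT (\<iota> \<alpha>) \<subseteq> GT (\<iota> \<alpha>) <+> base.GT \<alpha>"
      using base.GT_zero[of \<alpha>] GT_carr by (force simp: set_add_def set_mult_def)
  qed
  thus ?thesis by (auto simp: gr_map_def G_zero base.G_zero fun_eq_iff inj inv_into_f_f)
qed

text \<open>
  Either the class is zero, or \<open>\<beta>\<close> is the value of \<open>a\<close> and the class is the initial form of \<open>a\<close>.
\<close>

lemma homog_in_gr_subring:
  assumes a: "a \<in> K" "a \<in> GE \<beta>"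
  shows "homog \<beta> a \<in> gr_subring L K v \<iota> w"
proof (cases "a \<in> GT \<beta>")
  case True
  interpret bG: cring base.G by (rule base.G_cring)
  have "homog \<beta> a = gr_map L \<iota> w \<zero>\<^bsub>base.G\<^esub>"
    using homog_eq_zero_iff[OF a(2)] True gr_map_zero by simp
  then show ?thesis unfolding gr_subring_def by simp
next
  case False
  with a have "a \<noteq> \<zero>" "w a = \<beta>" by (auto simp: GE_iff GT_iff)
  moreover have "initial_form (L\<lparr>carrier := K\<rparr>) v a \<in> carrier base.G"
    using a by (simp add: base.initial_form_homog base.homog_closed base.GE_iff)
  ultimately show ?thesis
    using gr_map_initial_form[OF field_axioms K v \<iota> extends a(1)] initial_form_homog[of a]
    unfolding gr_subring_def by (metis imageI)
qed

end

locale maximal_initial_degree = valued_extension L w K v \<iota>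
  for L (structure) and w :: "'a \<Rightarrow> 'h::linordered_ab_group_add"
    and K v and \<iota> :: "'g::linordered_ab_group_add \<Rightarrow> 'h" +
  fixes x :: 'a and n :: nat
  assumes x: "x \<in> carrier L" "x \<noteq> \<zero>"
    and alg: "(algebraic over K) x"
    and gen: "simple_extension K x = carrier L"
    and n: "n = degree (Irr K x)"
    and deg: "p \<in> carrier ((gr_subring L K v \<iota> w)[X]\<^bsub>G\<^esub>) \<Longrightarrow> p \<noteq> [] \<Longrightarrow>
      ring.eval G p (initial_form L w x) = \<zero>\<^bsub>G\<^esub> \<Longrightarrow> n \<le> degree p"
begin

abbreviation "f \<equiv> Irr K x"

lemma Irr_set: "set f \<subseteq> K" and Irr_root: "eval f x = \<zero>" and length_Irr: "length f = Suc n"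
  and Irr_lead: "coeff f n = \<one>" and n_pos: "0 < n"
proof -
  note I = IrrE[OF K x(1) alg]
  have ne: "f \<noteq> []" using I(2) by (auto simp: ring_irreducible_def univ_poly_zero)
  show "set f \<subseteq> K" using I(1) ne by (auto simp: polynomial_def simp flip: univ_poly_carrier)
  show "eval f x = \<zero>" by (fact I(4))
  show len: "length f = Suc n" using ne n by simp
  show "coeff f n = \<one>" using I(3) lead_coeff_simp[OF ne] n by simp
  show "0 < n"
  proof (rule ccontr)
    assume "\<not> 0 < n"
    then obtain a where "f = [a]" using len by (auto simp: length_Suc_conv)
    with I(3,4) x show False by simp
  qed
qed

lemma coeff_in_K: "set p \<subseteq> K \<Longrightarrow> coeff p i \<in> K"
proof (cases "i < length p")
  case True
  then show "set p \<subseteq> K \<Longrightarrow> coeff p i \<in> K" using coeff_in_set by blast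
next
  case False
  then show ?thesis using coeff_length zero_in_K by simp
qed

text \<open>
  The hypothesis on the degree is used here: under these assumptions the part of value \<open>\<beta>\<close> of
  \<open>p\<close> is a non-zero polynomial over the graded ring of \<open>K\<close> that vanishes at the initial form of \<open>x\<close>.
  Its leading coefficient sits in a degree \<open>k \<ge> n\<close>.
\<close>

lemma high_term_in_relation:
  assumes p: "set p \<subseteq> K" and GE: "\<And>i. i < length p \<Longrightarrow> coeff p i \<otimes> x [^] i \<in> GE \<beta>"
    and GT: "eval p x \<in> GT \<beta>" and j: "j < length p" "coeff p j \<otimes> x [^] j \<notin> GT \<beta>"
  obtains k where "n \<le> k" "k < length p" "coeff p k \<otimes> x [^] k \<notin> GT \<beta>"
proof -
  interpret G: cring G by (rule G_cring)
  define q where "q = initial_poly \<beta> (w x) p"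
  let ?q = "G.normalize q"
  have pc: "set p \<subseteq> carrier L" using p K_sub by blast
  have cGE: "coeff p i \<in> GE (\<beta> - i \<bullet> w x)" if "i < length p" for i
    using GE[OF that] coeff_in_K[OF p] K_sub x term_GE_iff by blast
  have zero_iff: "G.coeff q i = \<zero>\<^bsub>G\<^esub> \<longleftrightarrow> coeff p i \<otimes> x [^] i \<in> GT \<beta>" if "i < length p" for i
    using that homog_eq_zero_iff[OF cGE[OF that]] coeff_in_K[OF p] K_sub x term_GT_iff[of x "coeff p i"]
    by (auto simp: q_def coeff_initial_poly)
  have set_q: "set q \<subseteq> (\<lambda>i. homog (\<beta> - i \<bullet> w x) (coeff p i)) ` {..<length p}"
    unfolding q_def by (rule set_initial_poly)
  have "set q \<subseteq> gr_subring L K v \<iota> w"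
    by (rule order.trans[OF set_q], rule image_subsetI) (simp add: homog_in_gr_subring coeff_in_K[OF p] cGE)
  moreover have "set q \<subseteq> carrier G"
    by (rule order.trans[OF set_q], rule image_subsetI) (simp add: homog_closed cGE)
  moreover have "initial_form L w x \<in> carrier G"
    using x by (simp add: initial_form_homog homog_closed GE_iff)
  moreover have "G.eval q (initial_form L w x) = \<zero>\<^bsub>G\<^esub>"
    using eval_initial_poly[OF x pc GE] homog_eq_zero_iff[OF GT_GE[OF GT]] GT by (simp add: q_def)
  ultimately have q: "?q \<in> carrier ((gr_subring L K v \<iota> w)[X]\<^bsub>G\<^esub>)"
      "G.eval ?q (initial_form L w x) = \<zero>\<^bsub>G\<^esub>"
    using G.normalize_gives_polynomial G.eval_normalize by (auto simp: univ_poly_carrier)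
  have ne: "?q \<noteq> []"
  proof
    assume "?q = []"
    hence "G.coeff q j = \<zero>\<^bsub>G\<^esub>" by (subst G.normalize_coeff) simp
    thus False using zero_iff[OF j(1)] j(2) by simp
  qed
  have "n \<le> degree ?q" using deg[OF q(1) ne q(2)] .
  moreover have "degree ?q < length p"
    using G.normalize_length_le[of q] ne by (cases ?q) (auto simp: q_def)
  moreover have "G.coeff q (degree ?q) \<noteq> \<zero>\<^bsub>G\<^esub>"
    using G.normalize_gives_polynomial[OF order.refl, of q] ne
    by (subst G.normalize_coeff) (cases ?q; simp add: polynomial_def)
  ultimately show ?thesis using that zero_iff by blast
qed

lemma coeff_in_L: "set p \<subseteq> K \<Longrightarrow> coeff p i \<in> carrier L"
  using coeff_in_K K_sub by blast

text \<open>
  A sum of larger value than the minimum of its terms would be a relation without terms of degree at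
  least \<open>n\<close>.
\<close>

lemma low_degree_value:
  assumes p: "set p \<subseteq> K" "length p \<le> n" and nz: "eval p x \<noteq> \<zero>"
  obtains i where "i < length p" "coeff p i \<noteq> \<zero>" "w (eval p x) = w (coeff p i) + i \<bullet> w x"
    "\<And>j. j < length p \<Longrightarrow> coeff p j \<noteq> \<zero> \<Longrightarrow> w (coeff p i) + i \<bullet> w x \<le> w (coeff p j) + j \<bullet> w x"
proof -
  have pc: "set p \<subseteq> carrier L" using p K_sub by blast
  note cc = coeff_in_L[OF p(1)]
  have "\<exists>i < length p. coeff p i \<noteq> \<zero>"
  proof (rule ccontr)
    assume "\<not> (\<exists>i < length p. coeff p i \<noteq> \<zero>)"
    hence "coeff p i \<otimes> x [^] i \<in> GT (w (eval p x))" if "i < length p" for i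
      using that x GT_zero by auto
    then obtain r where r: "r \<in> GT (w (eval p x))" "eval p x = r \<oplus> coeff p (length p) \<otimes> x [^] length p"
      using eval_congruent_term[OF x(1) pc, of "length p"] by blast
    have "eval p x = r" using r coeff_length[of p "length p"] x GT_carr[OF r(1)] by simp
    with r(1) nz show False by (simp add: GT_iff)
  qed
  then obtain i where i: "i < length p" "coeff p i \<otimes> x [^] i \<notin> GT (w (coeff p i \<otimes> x [^] i))"
    and GE: "\<And>j. j < length p \<Longrightarrow> coeff p j \<otimes> x [^] j \<in> GE (w (coeff p i \<otimes> x [^] i))"
    using minimal_term[OF x pc] by blast
  have ci: "coeff p i \<noteq> \<zero>" using i(2) x GT_zero by auto
  note wi = v_term[OF x cc ci]
  have "eval p x \<notin> GT (w (coeff p i \<otimes> x [^] i))"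
    using high_term_in_relation[OF p(1) GE _ i] p(2) by (metis leD order.strict_trans2)
  moreover have "eval p x \<in> GE (w (coeff p i \<otimes> x [^] i))" by (rule eval_GE[OF x(1) pc GE])
  ultimately have "w (eval p x) = w (coeff p i) + i \<bullet> w x" 
    using nz wi by (auto simp: GE_iff GT_iff)
  moreover have "w (coeff p i) + i \<bullet> w x \<le> w (coeff p j) + j \<bullet> w x"
    if "j < length p" "coeff p j \<noteq> \<zero>" for j
    using GE[OF that(1)] v_term[OF x cc that(2), of j] wi by (auto simp: GE_iff)
  ultimately show ?thesis using that i(1) ci by blast
qed

abbreviation "c \<equiv> coeff f"

lemma c_in_K: "c i \<in> K" and c_in_L: "c i \<in> carrier L"
  using coeff_in_K[OF Irr_set] coeff_in_L[OF Irr_set] by auto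

text \<open>
  The minimal polynomial is itself a relation, and \<open>n\<close> is the only degree in which
  \<open>high_term_in_relation\<close> can find its term of minimal value.
\<close>

lemma Irr_term_above_leading: "i \<le> n \<Longrightarrow> c i \<otimes> x [^] i \<in> GE (n \<bullet> w x)"
proof -
  assume le: "i \<le> n"
  have pc: "set f \<subseteq> carrier L" using Irr_set K_sub by blast
  have "\<exists>i < length f. c i \<noteq> \<zero>" using length_Irr Irr_lead by (intro exI[of _ n]) simp
  then obtain m where m: "m < length f" "c m \<otimes> x [^] m \<notin> GT (w (c m \<otimes> x [^] m))"
    and GE: "\<And>j. j < length f \<Longrightarrow> c j \<otimes> x [^] j \<in> GE (w (c m \<otimes> x [^] m))"
    using minimal_term[OF x pc] by blast
  obtain k where "n \<le> k" "k < length f" "c k \<otimes> x [^] k \<notin> GT (w (c m \<otimes> x [^] m))"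
    using high_term_in_relation[OF Irr_set GE _ m] Irr_root GT_zero by metis
  moreover from this length_Irr have "k = n" by simp
  ultimately have "x [^] n \<notin> GT (w (c m \<otimes> x [^] m))" "x [^] n \<in> GE (w (c m \<otimes> x [^] m))"
    using Irr_lead GE[of n] length_Irr x by auto
  hence "w (c m \<otimes> x [^] m) = n \<bullet> w x" using v_pow[OF x, of n] x by (auto simp: GE_iff GT_iff)
  thus ?thesis using GE[of i] le length_Irr by simp
qed

text \<open>
  Otherwise the constant term could be dropped from the relation, and division by \<open>x\<close> would leave a
  relation of degree \<open>n - 1\<close>.
\<close>

lemma Irr_const_not_above_leading: "c 0 \<notin> GT (n \<bullet> w x)"
proof
  assume c0: "c 0 \<in> GT (n \<bullet> w x)"
  define \<beta> where "\<beta> = n \<bullet> w x - w x"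
  obtain p a where pa: "f = p @ [a]" using length_Irr by (metis length_0_conv nat.distinct(1) rev_exhaust)
  have coeff_snoc: "coeff (q @ [a]) (Suc i) = coeff q i" and coeff_snoc0: "coeff (q @ [a]) 0 = a" for q i
    by (induction q) auto
  have p: "set p \<subseteq> K" and len: "length p = n" using pa Irr_set length_Irr by auto
  have pc: "set p \<subseteq> carrier L" using p K_sub by blast
  have a: "a = c 0" using coeff_snoc0[of p] pa by simp
  have GE: "coeff p i \<otimes> x [^] i \<in> GE \<beta>" if "i < length p" for i
  proof -
    have "coeff p i \<otimes> x [^] Suc i \<in> GE (n \<bullet> w x)"
      using Irr_term_above_leading[of "Suc i"] that len coeff_snoc[of p i] pa by simp
    moreover have "n \<bullet> w x - Suc i \<bullet> w x = \<beta> - i \<bullet> w x"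
      by (simp add: \<beta>_def diff_diff_add)
    ultimately show ?thesis using term_GE_iff[OF x coeff_in_L[OF p, of i]] by metis
  qed
  have e: "eval p x \<in> carrier L" using eval_in_carrier[OF pc x(1)] .
  have "a \<in> carrier L" using a c_in_L by metis
  from eval_append_aux[OF pc this x(1)] have "eval p x \<otimes> x \<oplus> a = \<zero>"
    unfolding pa[symmetric] Irr_root by simp
  hence "eval p x \<otimes> x \<oplus> c 0 = \<zero>" unfolding a .
  hence "eval p x \<otimes> x = \<ominus> c 0" using minus_equality[of "eval p x \<otimes> x" "c 0"] e x(1) c_in_L by simp
  hence "eval p x \<otimes> x [^] (1::nat) \<in> GT (n \<bullet> w x)" using GT_neg[OF c0] x by simp
  hence GT: "eval p x \<in> GT \<beta>" using term_GT_iff[OF x e, of 1] by (simp add: \<beta>_def)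
  have "n - 1 < length p" "coeff p (n - 1) = \<one>"
    using coeff_snoc[of p "n - 1"] Irr_lead len n_pos pa by auto
  moreover have "x [^] (n - 1) \<notin> GT \<beta>"
  proof -
    obtain m where "n = Suc m" using n_pos by (cases n) auto
    thus ?thesis using v_pow[OF x, of m] by (simp add: \<beta>_def GT_iff)
  qed
  ultimately obtain k where "n \<le> k" "k < length p"
    using high_term_in_relation[OF p GE GT, of "n - 1"] x by auto
  with len show False by simp
qed

lemma Irr_const_nonzero: "c 0 \<noteq> \<zero>"
  using Irr_const_not_above_leading GT_zero by metis

lemma generator_value: "n \<bullet> w x = \<iota> (v (c 0))"
  using Irr_term_above_leading[of 0] Irr_const_not_above_leading Irr_const_nonzero c_in_L[of 0] w_v[OF c_in_K Irr_const_nonzero]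
  by (auto simp: GE_iff GT_iff)

text \<open>
  The points \<open>(i, v (c i))\<close> lie on or above the segment joining \<open>(0, v (c 0))\<close> to \<open>(n, 0)\<close>.
  Multiplying by \<open>n\<close> replaces \<open>w x\<close> by the value of \<open>c 0\<close>, so that the inequality lives in the value group of \<open>K\<close> and
  passes to every extension.
\<close>

lemma Irr_one_slope:
  assumes "i \<le> n" "c i \<noteq> \<zero>"
  shows "n \<bullet> v (c 0) \<le> n \<bullet> v (c i) + i \<bullet> v (c 0)"
proof -
  have "n \<bullet> w x \<le> \<iota> (v (c i)) + i \<bullet> w x"
    using Irr_term_above_leading[OF assms(1)] v_term[OF x c_in_L assms(2), of i] w_v[OF c_in_K assms(2)]
    by (auto simp: GE_iff)
  hence "n \<bullet> n \<bullet> w x \<le> n \<bullet> (\<iota> (v (c i)) + i \<bullet> w x)" using nmul_le_iff n_pos by blast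
  also have "\<dots> = n \<bullet> \<iota> (v (c i)) + i \<bullet> n \<bullet> w x" by (simp add: nmul_add_right nmul_commute)
  finally have "\<iota> (n \<bullet> v (c 0)) \<le> \<iota> (n \<bullet> v (c i) + i \<bullet> v (c 0))"
    by (simp add: generator_value emb_add[OF \<iota>] emb_nmul[OF \<iota>])
  thus ?thesis using emb_le_iff[OF \<iota>] by blast
qed

context
  fixes u :: "'a \<Rightarrow> 'k::linordered_ab_group_add" and \<kappa> :: "'g \<Rightarrow> 'k"
  assumes \<kappa>: "ordered_group_embedding \<kappa>" and u: "extends_valuation L K v \<kappa> u"
begin

interpretation U: valued_extension L u K v \<kappa>
  using K v \<kappa> u field_axioms
  by (auto simp: valued_extension_def valued_extension_axioms_def valued_field_def
      valued_field_axioms_def extends_valuation_def)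

lemma Irr_one_slope_other: 
  assumes "i \<le> n" "c i \<noteq> \<zero>"
  shows "n \<bullet> u (c 0) \<le> n \<bullet> u (c i) + i \<bullet> u (c 0)"
  using Irr_one_slope[OF assms] emb_le_iff[OF \<kappa>] U.w_v[OF c_in_K assms(2)] U.w_v[OF c_in_K Irr_const_nonzero]
  by (metis emb_add[OF \<kappa>] emb_nmul[OF \<kappa>])

text \<open>
  If \<open>n \<bullet> u x\<close> were smaller than \<open>u (c 0)\<close>, then \<open>x\<^sup>n\<close> would be the only term of minimal value in
  the minimal relation; if it were larger, \<open>c 0\<close> would be.
\<close>

lemma generator_value_other: "n \<bullet> u x = \<kappa> (v (c 0))"
proof -
  let ?d = "n \<bullet> u x" and ?e = "u (c 0)"
  have pc: "set f \<subseteq> carrier L" using Irr_set K_sub by blast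
  have val_term: "n \<bullet> u (c i \<otimes> x [^] i) = n \<bullet> u (c i) + i \<bullet> ?d" if "c i \<noteq> \<zero>" for i
    using U.v_term[OF x c_in_L that, of i] by (simp add: nmul_add_right nmul_commute)
  have termI: "c i \<otimes> x [^] i \<in> U.GT \<beta>" if "c i \<noteq> \<zero> \<Longrightarrow> n \<bullet> \<beta> < n \<bullet> u (c i \<otimes> x [^] i)" for i \<beta>
    using that n_pos x c_in_L[of i] by (cases "c i = \<zero>") (auto simp: U.GT_iff nmul_less_iff)
  have "?d = ?e"
  proof (rule linorder_cases)
    assume lt: "?d < ?e"
    have "c i \<otimes> x [^] i \<in> U.GT ?d" if "i < length f" "i \<noteq> n" for i
    proof (rule termI)
      assume ci: "c i \<noteq> \<zero>"
      obtain m where m: "n = m + i" "0 < m" using \<open>i < length f\<close> \<open>i \<noteq> n\<close> length_Irr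
        by (metis add.commute less_Suc_eq less_imp_add_positive)
      have "m \<bullet> ?e \<le> n \<bullet> u (c i)" using Irr_one_slope_other[of i] ci m(1) by (simp add: nmul_add_left)
      moreover have "m \<bullet> ?d < m \<bullet> ?e" using lt m(2) by (rule nmul_strict_mono)
      ultimately have "m \<bullet> ?d + i \<bullet> ?d < n \<bullet> u (c i) + i \<bullet> ?d" by simp
      moreover have "n \<bullet> ?d = m \<bullet> ?d + i \<bullet> ?d" by (subst m(1)) (rule nmul_add_left)
      ultimately show "n \<bullet> ?d < n \<bullet> u (c i \<otimes> x [^] i)" using val_term[OF ci] by simp
    qed
    hence "c n \<otimes> x [^] n \<in> U.GT ?d" by (rule U.root_term_GT[OF x(1) pc Irr_root])
    thus ?thesis using Irr_lead U.v_pow[OF x, of n] x by (simp add: U.GT_iff)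
  next
    assume lt: "?e < ?d"
    have "c i \<otimes> x [^] i \<in> U.GT ?e" if "i < length f" "i \<noteq> 0" for i
    proof (rule termI)
      assume ci: "c i \<noteq> \<zero>"
      have "n \<bullet> ?e \<le> n \<bullet> u (c i) + i \<bullet> ?e" using Irr_one_slope_other[of i] ci that length_Irr by simp
      also have "\<dots> < n \<bullet> u (c i) + i \<bullet> ?d" using nmul_strict_mono[OF lt] that by simp
      finally show "n \<bullet> ?e < n \<bullet> u (c i \<otimes> x [^] i)" using val_term[OF ci] by simp
    qed
    hence "c 0 \<otimes> x [^] (0::nat) \<in> U.GT ?e" by (rule U.root_term_GT[OF x(1) pc Irr_root])
    thus ?thesis using Irr_const_nonzero c_in_L[of 0] by (simp add: U.GT_iff)
  qed
  thus ?thesis using U.w_v[OF c_in_K Irr_const_nonzero] by simp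
qed

text \<open>
  The value \<open>w y\<close> equals that of a term of minimal value, whereas for \<open>u\<close> only the inequality is
  available. The values of the terms multiplied by \<open>n\<close> come from the value group of \<open>K\<close>, so
  they are ordered in the same way for \<open>u\<close> as for \<open>w\<close>.
\<close>

lemma value_le_other:
  assumes y: "y \<in> carrier L" "y \<noteq> \<zero>"
  obtains g where "n \<bullet> w y = \<iota> g" "\<kappa> g \<le> n \<bullet> u y"
proof -
  have "y \<in> Span K (exp_base x n)" using y(1) Span_exp_base[OF K x(1) alg] gen n by simp
  then obtain p where p: "p \<in> carrier (K[X])" "length p \<le> n" "y = eval p x"
    unfolding Span_eq_eval_img[OF K x(1)] by blast
  have pK: "set p \<subseteq> K" using p(1) polynomial_incl by (auto simp flip: univ_poly_carrier)
  hence pc: "set p \<subseteq> carrier L" using K_sub by blast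
  obtain i where i: "i < length p" "coeff p i \<noteq> \<zero>" "w y = w (coeff p i) + i \<bullet> w x"
    and min: "\<And>j. j < length p \<Longrightarrow> coeff p j \<noteq> \<zero> \<Longrightarrow> w (coeff p i) + i \<bullet> w x \<le> w (coeff p j) + j \<bullet> w x"
    using low_degree_value[OF pK p(2)] y(2) p(3) by blast
  define g where "g j = n \<bullet> v (coeff p j) + j \<bullet> v (c 0)" for j
  have w_g: "n \<bullet> (w (coeff p j) + j \<bullet> w x) = \<iota> (g j)" if "coeff p j \<noteq> \<zero>" for j
    using w_v[OF coeff_in_K[OF pK] that] generator_value nmul_commute[of n j "w x"]
    by (simp add: g_def nmul_add_right emb_add[OF \<iota>] emb_nmul[OF \<iota>])
  have u_g: "n \<bullet> (u (coeff p j) + j \<bullet> u x) = \<kappa> (g j)" if "coeff p j \<noteq> \<zero>" for j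
    using U.w_v[OF coeff_in_K[OF pK] that] generator_value_other nmul_commute[of n j "u x"]
    by (simp add: g_def nmul_add_right emb_add[OF \<kappa>] emb_nmul[OF \<kappa>])
  let ?\<beta> = "u (coeff p i) + i \<bullet> u x"
  have "coeff p j \<otimes> x [^] j \<in> U.GE ?\<beta>" if j: "j < length p" for j
  proof (cases "coeff p j = \<zero>")
    case True
    then show ?thesis using x by (simp add: U.GE_zero)
  next
    case False
    have "g i \<le> g j"
      using min[OF j False] w_g[OF False] w_g[OF i(2)] nmul_le_iff[OF n_pos] emb_le_iff[OF \<iota>] by metis
    hence "?\<beta> \<le> u (coeff p j) + j \<bullet> u x"
      using u_g[OF False] u_g[OF i(2)] nmul_le_iff[OF n_pos] emb_le_iff[OF \<kappa>] by metis
    then show ?thesis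
      using U.v_term[OF x coeff_in_L[OF pK] False, of j] x coeff_in_L[OF pK] by (simp add: U.GE_iff)
  qed
  hence "y \<in> U.GE ?\<beta>" using U.eval_GE[OF x(1) pc] p(3) by simp
  hence "?\<beta> \<le> u y" using y(2) by (simp add: U.GE_iff)
  hence "\<kappa> (g i) \<le> n \<bullet> u y" using u_g[OF i(2)] nmul_le_iff[OF n_pos] by metis
  moreover have "n \<bullet> w y = \<iota> (g i)" using i(3) w_g[OF i(2)] by simp
  ultimately show ?thesis using that by blast
qed

text \<open>
  Passing to the inverse turns the inequality around.
\<close>

lemma value_determined:
  assumes y: "y \<in> carrier L" "y \<noteq> \<zero>"
  obtains g where "n \<bullet> w y = \<iota> g" "n \<bullet> u y = \<kappa> g"
proof -
  have inv: "inv y \<in> carrier L" "inv y \<noteq> \<zero>" "y \<otimes> inv y = \<one>"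
    using y field_Units by (auto simp: zero_not_one dest: Units_inv_Units)
  have "w y + w (inv y) = 0" "u y + u (inv y) = 0"
    using v_mult[OF y(1) inv(1) y(2) inv(2)] U.v_mult[OF y(1) inv(1) y(2) inv(2)] inv(3) v_one U.v_one by auto
  hence neg: "w (inv y) = - w y" "u (inv y) = - u y" by (simp_all add: eq_neg_iff_add_eq_0 add.commute)
  obtain g where g: "n \<bullet> w y = \<iota> g" "\<kappa> g \<le> n \<bullet> u y" using value_le_other[OF y] .
  obtain h where h: "n \<bullet> w (inv y) = \<iota> h" "\<kappa> h \<le> n \<bullet> u (inv y)" using value_le_other[OF inv(1,2)] .
  have "\<iota> h = \<iota> (- g)" using g(1) h(1) neg by (simp add: nmul_uminus emb_uminus[OF \<iota>])
  hence "h = - g" using emb_eq_iff[OF \<iota>] by blast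
  hence "n \<bullet> u y \<le> \<kappa> g" using h(2) neg by (simp add: nmul_uminus emb_uminus[OF \<kappa>])
  with g show ?thesis using that by (simp add: order.antisym)
qed

end

end

theorem corollary67:
  fixes L :: "('a, 'b) ring_scheme" (structure)
    and K :: "'a set"
    and x :: 'a
    and n :: nat
    and \<nu> :: "'a \<Rightarrow> 'g::linordered_ab_group_add"
    and \<iota> :: "'g \<Rightarrow> 'h::linordered_ab_group_add"
    and \<nu>' :: "'a \<Rightarrow> 'h"
  assumes "field L" and "subfield K L"
    and "ring.finite_dimension L K (carrier L)"
    and "ring.separable_extension L K"
    and "x \<in> carrier L" and "ring.simple_extension L K x = carrier L"
    and "n = degree (ring.Irr L K x)"
    and "valuation (L\<lparr>carrier := K\<rparr>) \<nu>"
    and "ordered_group_embedding \<iota>"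
    and "extends_valuation L K \<nu> \<iota> \<nu>'"
    and "ring.has_degree_over (gr_ring L \<nu>') (gr_subring L K \<nu> \<iota> \<nu>') (initial_form L \<nu>' x) n"
  shows "(\<exists>!w :: 'a \<Rightarrow> 'h. w \<in> extensional (carrier L - {\<zero>}) \<and> extends_valuation L K \<nu> \<iota> w) \<and>
    (\<forall>(\<kappa> :: 'g \<Rightarrow> 'k::linordered_ab_group_add) (w :: 'a \<Rightarrow> 'k).
       ordered_group_embedding \<kappa> \<and> extends_valuation L K \<nu> \<kappa> w \<longrightarrow> equivalent_valuations L \<nu>' w)"
proof -
  interpret valued_extension L \<nu>' K \<nu> \<iota>
    using assms(1,2,8-10)
    by (auto simp: valued_extension_def valued_extension_axioms_def valued_field_def
        valued_field_axioms_def extends_valuation_def)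
  have alg: "(algebraic over K) x"
    using finite_dimension_imp_algebraic[OF K carrier_is_subring assms(3,5)] .
  have n: "0 < n"
    using pirreducible_degree[OF K IrrE(1,2)[OF K assms(5) alg]] assms(7) by simp
  have determined: "\<exists>g. n \<bullet> \<nu>' y = \<iota> g \<and> n \<bullet> u y = \<kappa> g"
    if \<kappa>: "ordered_group_embedding \<kappa>" and u: "extends_valuation L K \<nu> \<kappa> u"
      and y: "y \<in> carrier L" "y \<noteq> \<zero>" for \<kappa> :: "'g \<Rightarrow> 'm::linordered_ab_group_add" and u y
  proof (cases "x = \<zero>")
    case True
    \<comment> \<open>The value at zero is arbitrary, so it cannot be compared with that of \<open>c 0\<close>; but \<open>L = K\<close>.\<close>
    have "simple_extension K x \<subseteq> K"
      using simple_extension_subring_incl[OF subfieldE(1)[OF K] order.refl] True zero_in_K by simp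
    hence "y \<in> K" using y(1) assms(6) by blast
    then show ?thesis
      using w_v[of y] u y(2) emb_nmul[OF \<iota>] emb_nmul[OF \<kappa>]
      by (intro exI[of _ "n \<bullet> \<nu> y"]) (auto simp: extends_valuation_def)
  next
    case False
    interpret maximal_initial_degree L \<nu>' K \<nu> \<iota> x n
    proof unfold_locales
      show "n \<le> degree p" if "p \<in> carrier ((gr_subring L K \<nu> \<iota> \<nu>')[X]\<^bsub>G\<^esub>)" "p \<noteq> []"
        "ring.eval G p (initial_form L \<nu>' x) = \<zero>\<^bsub>G\<^esub>" for p
        using that assms(11) ring.has_degree_over_def[OF cring.axioms(1)[OF G_cring]] by blast
    qed (fact assms(5) False alg assms(6,7))+
    show ?thesis by (rule value_determined[OF \<kappa> u y]) blast
  qed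
  show ?thesis
  proof (intro conjI allI impI)
    show "\<exists>!w :: 'a \<Rightarrow> 'h. w \<in> extensional (carrier L - {\<zero>}) \<and> extends_valuation L K \<nu> \<iota> w"
    proof (rule ex1I, intro conjI)
      show "extends_valuation L K \<nu> \<iota> (restrict \<nu>' (carrier L - {\<zero>}))"
        using extends K_sub by (auto simp: extends_valuation_def valuation_def integral_iff)
      show "w = restrict \<nu>' (carrier L - {\<zero>})"
        if w: "w \<in> extensional (carrier L - {\<zero>}) \<and> extends_valuation L K \<nu> \<iota> w" for w
      proof (rule extensionalityI)
        show "w y = restrict \<nu>' (carrier L - {\<zero>}) y" if y: "y \<in> carrier L - {\<zero>}" for y
        proof -
          obtain g where "n \<bullet> \<nu>' y = \<iota> g" "n \<bullet> w y = \<iota> g"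
            using determined[OF \<iota> conjunct2[OF w], of y] y by blast
          hence "w y = \<nu>' y" using nmul_eq_iff[OF n, of "w y" "\<nu>' y"] by simp
          thus ?thesis using y by simp
        qed
      qed (use w in simp_all)
    qed simp
  next
    fix \<kappa> :: "'g \<Rightarrow> 'k" and u :: "'a \<Rightarrow> 'k"
    assume *: "ordered_group_embedding \<kappa> \<and> extends_valuation L K \<nu> \<kappa> u"
    let ?X = "carrier L - {\<zero>}"
    have le_iff: "u y \<le> u z \<longleftrightarrow> \<nu>' y \<le> \<nu>' z" if yz: "y \<in> ?X" "z \<in> ?X" for y z
    proof -
      obtain g h where "n \<bullet> \<nu>' y = \<iota> g" "n \<bullet> u y = \<kappa> g" "n \<bullet> \<nu>' z = \<iota> h" "n \<bullet> u z = \<kappa> h"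
        using determined[of \<kappa> u] * yz by (metis DiffE singletonI)
      thus ?thesis using nmul_le_iff[OF n] emb_le_iff * \<iota> by metis
    qed
    \<comment> \<open>Both valuations order \<open>L\<close> in the same way, so the choice of a preimage does not matter.\<close>
    define \<phi> where "\<phi> \<alpha> = u (inv_into ?X \<nu>' \<alpha>)" for \<alpha>
    have \<phi>: "\<phi> (\<nu>' y) = u y" if "y \<in> ?X" for y
    proof -
      have "inv_into ?X \<nu>' (\<nu>' y) \<in> ?X" "\<nu>' (inv_into ?X \<nu>' (\<nu>' y)) = \<nu>' y"
        using that inv_into_into[of "\<nu>' y" \<nu>' ?X] f_inv_into_f[of "\<nu>' y" \<nu>' ?X] by blast+
      thus ?thesis using le_iff that unfolding \<phi>_def by (metis order.antisym order.refl)
    qed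
    have u_mult: "u (y \<otimes> z) = u y + u z" if "y \<in> ?X" "z \<in> ?X" for y z
      using * that by (simp add: extends_valuation_def valuation_def)
    show "equivalent_valuations L \<nu>' u"
      unfolding equivalent_valuations_def
    proof (intro exI[of _ \<phi>] conjI ballI)
      show mono: "strict_mono_on (\<nu>' ` ?X) \<phi>"
        using le_iff \<phi> by (intro strict_mono_onI) (auto simp flip: not_le)
      show "bij_betw \<phi> (\<nu>' ` ?X) (u ` ?X)"
        unfolding bij_betw_def using strict_mono_on_imp_inj_on[OF mono] \<phi> by (auto simp: image_image)
      show "\<phi> (\<alpha> + \<beta>) = \<phi> \<alpha> + \<phi> \<beta>" if \<alpha>\<beta>: "\<alpha> \<in> \<nu>' ` ?X" "\<beta> \<in> \<nu>' ` ?X" for \<alpha> \<beta>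
      proof -
        obtain y z where yz: "y \<in> ?X" "z \<in> ?X" "\<alpha> = \<nu>' y" "\<beta> = \<nu>' z" using \<alpha>\<beta> by blast
        hence "\<nu>' (y \<otimes> z) = \<alpha> + \<beta>" "y \<otimes> z \<in> ?X" by (auto simp: v_mult integral_iff)
        thus ?thesis using \<phi> u_mult yz by metis
      qed
      show "u y = \<phi> (\<nu>' y)" if "y \<in> ?X" for y using \<phi> that by simp
    qed
  qed
qed

end
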